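(* The problem SetCovering over definable structures is decidable: there is an algorithm which, given (finite presentations of) a definable set $X$ and a definable family $\mathcal{S}$ of subsets of $X$, decides whether $\mathcal{S}$ contains a finite subfamily $C$ whose union is $X$.
   Context: Fix a countably infinite set $\mathbb{A}$ of atoms and an infinite set of atom variables. An expression is either a variable or a formal finite (possibly empty) union of set-builder expressions $\{e \mid x_1,\dots,x_k\in\mathbb{A},\ \varphi\}$ (with $k\ge 0$), where $e$ is an expression, the $x_i$ are bound variables, and $\varphi$ is a first-order formula over the atom variables with equality as the only relation symbol (interpreted in $(\mathbb{A},=)$). An expression $e$ with set of free variables $V$, together with a valuation $\sigma:V\to\mathbb{A}$, has a value $e[\sigma]$, defined in the obvious way by induction on $e$, which is an atom or a set; the sets arising this way are called definable. Pairs, tuples, integers, constants, disjoint unions etc. are encoded by standard set-theoretic means (e.g. $(x,y)=\{x,\{x,y\}\}$). A definable set is presented to an algorithm as a pair $(e,\sigma)$. *)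

theory Defs
  imports "HOL-Library.Countable_Set_Type" "HOL-Library.Nat_Bijection"
begin

section \<open>Sets with atoms\<close>

text \<open>Hereditarily countable sets over atoms of type \<open>'a\<close>. Every definable set is of this
  kind, since a set-builder expression binds finitely many variables ranging over a countable set.
  Equality on this type is extensional.\<close>

datatype 'a hset = Atom 'a | Set "'a hset cset"

primrec elems :: "'a hset \<Rightarrow> 'a hset set" where
  "elems (Atom a) = {}"
| "elems (Set c) = rcset c"

abbreviation is_set :: "'a hset \<Rightarrow> bool" where
  "is_set v \<equiv> (\<exists>c. v = Set c)"


section \<open>Expressions and their values\<close>

type_synonym var = nat

text \<open>First-order formulas over equality; the other connectives and the universal quantifier are
  the usual abbreviations.\<close>

datatype fm = FEq var var | FNeg fm | FConj fm fm | FEx var fm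

primrec fv_fm :: "fm \<Rightarrow> var set" where
  "fv_fm (FEq x y) = {x, y}"
| "fv_fm (FNeg \<phi>) = fv_fm \<phi>"
| "fv_fm (FConj \<phi> \<psi>) = fv_fm \<phi> \<union> fv_fm \<psi>"
| "fv_fm (FEx x \<phi>) = fv_fm \<phi> - {x}"

primrec sat :: "(var \<Rightarrow> 'a) \<Rightarrow> fm \<Rightarrow> bool" where
  "sat \<sigma> (FEq x y) \<longleftrightarrow> \<sigma> x = \<sigma> y"
| "sat \<sigma> (FNeg \<phi>) \<longleftrightarrow> \<not> sat \<sigma> \<phi>"
| "sat \<sigma> (FConj \<phi> \<psi>) \<longleftrightarrow> sat \<sigma> \<phi> \<and> sat \<sigma> \<psi>"
| "sat \<sigma> (FEx x \<phi>) \<longleftrightarrow> (\<exists>a. sat (\<sigma>(x := a)) \<phi>)"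

text \<open>\<open>FUnion [\<dots>, (e, [x\<^sub>1, \<dots>, x\<^sub>k], \<phi>), \<dots>]\<close> is the formal union of the set-builder expressions
  \<open>{e | x\<^sub>1, \<dots>, x\<^sub>k \<in> \<bbbA>, \<phi>}\<close>. A repeated bound variable has the same meaning as a single
  occurrence.\<close>

datatype expr = Var var | FUnion "(expr \<times> var list \<times> fm) list"

fun fv :: "expr \<Rightarrow> var set" where
  "fv (Var x) = {x}"
| "fv (FUnion bs) = (\<Union>(e, xs, \<phi>)\<in>set bs. (fv e \<union> fv_fm \<phi>) - set xs)"

text \<open>The valuations that arise from \<open>\<sigma>\<close> by choosing atoms for the variables \<open>xs\<close>.\<close>

definition variants :: "(var \<Rightarrow> 'a) \<Rightarrow> var list \<Rightarrow> (var \<Rightarrow> 'a) set" where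
  "variants \<sigma> xs = {\<tau>. \<forall>y. y \<notin> set xs \<longrightarrow> \<tau> y = \<sigma> y}"

text \<open>The conversion \<open>acset\<close> is only meaningful on countable sets; for countably many atoms this
  is the case here, see \<open>elems_eval_FUnion\<close> below.\<close>

fun eval :: "expr \<Rightarrow> (var \<Rightarrow> 'a) \<Rightarrow> 'a hset" where
  "eval (Var x) \<sigma> = Atom (\<sigma> x)"
| "eval (FUnion bs) \<sigma> =
     Set (acset (\<Union>(e, xs, \<phi>)\<in>set bs. (\<lambda>\<tau>. eval e \<tau>) ` {\<tau> \<in> variants \<sigma> xs. sat \<tau> \<phi>}))"

lemma countable_variants:
  fixes \<sigma> :: "var \<Rightarrow> 'a"
  assumes "countable (UNIV :: 'a set)"
  shows "countable (variants \<sigma> xs)"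
proof (induction xs arbitrary: \<sigma>)
  case Nil
  have "variants \<sigma> [] = {\<sigma>}" by (auto simp: variants_def)
  then show ?case by simp
next
  case (Cons x xs)
  have "variants \<sigma> (x # xs) \<subseteq> (\<Union>a\<in>UNIV. variants (\<sigma>(x := a)) xs)"
  proof
    fix \<tau> assume "\<tau> \<in> variants \<sigma> (x # xs)"
    then have "\<tau> \<in> variants (\<sigma>(x := \<tau> x)) xs" by (auto simp: variants_def)
    then show "\<tau> \<in> (\<Union>a\<in>UNIV. variants (\<sigma>(x := a)) xs)" by blast
  qed
  moreover have "countable (\<Union>a\<in>(UNIV :: 'a set). variants (\<sigma>(x := a)) xs)"
    using assms Cons.IH by (intro countable_UN) auto
  ultimately show ?case by (rule countable_subset)
qed

lemma elems_eval_FUnion: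
  fixes \<sigma> :: "var \<Rightarrow> 'a"
  assumes "countable (UNIV :: 'a set)"
  shows "elems (eval (FUnion bs) \<sigma>) =
    {eval e \<tau> | e xs \<phi> \<tau>. (e, xs, \<phi>) \<in> set bs \<and> \<tau> \<in> variants \<sigma> xs \<and> sat \<tau> \<phi>}"
proof -
  have "countable (\<Union>(e, xs, \<phi>)\<in>set bs. (\<lambda>\<tau>. eval e \<tau>) ` {\<tau> \<in> variants \<sigma> xs. sat \<tau> \<phi>})"
    using countable_variants[OF assms]
    by (intro countable_UN countable_finite[OF finite_set])
      (auto intro!: countable_image elim: countable_subset[rotated])
  then show ?thesis by (simp add: acset_inverse) blast
qed

lemma sat_cong: "(\<And>x. x \<in> fv_fm \<phi> \<Longrightarrow> \<sigma> x = \<tau> x) \<Longrightarrow> sat \<sigma> \<phi> \<longleftrightarrow> sat \<tau> \<phi>"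
proof (induction \<phi> arbitrary: \<sigma> \<tau>)
  case (FEx x \<phi>)
  have "sat (\<sigma>(x := a)) \<phi> \<longleftrightarrow> sat (\<tau>(x := a)) \<phi>" for a
    by (rule FEx.IH) (use FEx.prems in auto)
  then show ?case by simp
next
  case (FConj \<phi> \<psi>)
  have "sat \<sigma> \<phi> \<longleftrightarrow> sat \<tau> \<phi>" "sat \<sigma> \<psi> \<longleftrightarrow> sat \<tau> \<psi>"
    using FConj.prems by (auto intro!: FConj.IH)
  then show ?case by simp
next
  case (FNeg \<phi>)
  have "sat \<sigma> \<phi> \<longleftrightarrow> sat \<tau> \<phi>" by (rule FNeg.IH) (use FNeg.prems in auto)
  then show ?case by simp
qed simp

lemma eval_cong: "(\<And>x. x \<in> fv e \<Longrightarrow> \<sigma> x = \<tau> x) \<Longrightarrow> eval e \<sigma> = eval e \<tau>"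
proof (induction e arbitrary: \<sigma> \<tau>)
  case (FUnion bs)
  have *: "eval e ` {\<rho> \<in> variants \<sigma> xs. sat \<rho> \<phi>} \<subseteq> eval e ` {\<rho> \<in> variants \<tau> xs. sat \<rho> \<phi>}"
    if b: "(e, xs, \<phi>) \<in> set bs" and eq: "\<And>x. x \<in> fv (FUnion bs) \<Longrightarrow> \<sigma> x = \<tau> x"
    for e xs \<phi> and \<sigma> \<tau> :: "var \<Rightarrow> 'a"
  proof
    fix v assume "v \<in> eval e ` {\<rho> \<in> variants \<sigma> xs. sat \<rho> \<phi>}"
    then obtain \<rho> where r: "\<rho> \<in> variants \<sigma> xs" "sat \<rho> \<phi>" "v = eval e \<rho>" by auto
    define \<rho>' where "\<rho>' = (\<lambda>x. if x \<in> set xs then \<rho> x else \<tau> x)"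
    have agree: "\<rho> x = \<rho>' x" if "x \<in> fv e \<union> fv_fm \<phi>" for x
      using that r(1) b eq[of x] by (auto simp: \<rho>'_def variants_def)
    have "eval e \<rho> = eval e \<rho>'"
      using b agree by (intro FUnion.IH[of "(e, xs, \<phi>)"]) auto
    moreover have "sat \<rho>' \<phi>" using r(2) agree sat_cong[of \<phi> \<rho> \<rho>'] by auto
    moreover have "\<rho>' \<in> variants \<tau> xs" by (auto simp: \<rho>'_def variants_def)
    ultimately show "v \<in> eval e ` {\<rho> \<in> variants \<tau> xs. sat \<rho> \<phi>}" using r(3) by auto
  qed
  have "eval e ` {\<rho> \<in> variants \<sigma> xs. sat \<rho> \<phi>} = eval e ` {\<rho> \<in> variants \<tau> xs. sat \<rho> \<phi>}"
    if "(e, xs, \<phi>) \<in> set bs" for e xs \<phi>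
  proof
    show "eval e ` {\<rho> \<in> variants \<sigma> xs. sat \<rho> \<phi>} \<subseteq> eval e ` {\<rho> \<in> variants \<tau> xs. sat \<rho> \<phi>}"
      by (rule *[OF that]) (rule FUnion.prems)
    show "eval e ` {\<rho> \<in> variants \<tau> xs. sat \<rho> \<phi>} \<subseteq> eval e ` {\<rho> \<in> variants \<sigma> xs. sat \<rho> \<phi>}"
      by (rule *[OF that]) (rule FUnion.prems[symmetric])
  qed
  then have "(\<Union>(e, xs, \<phi>)\<in>set bs. eval e ` {\<rho> \<in> variants \<sigma> xs. sat \<rho> \<phi>}) =
             (\<Union>(e, xs, \<phi>)\<in>set bs. eval e ` {\<rho> \<in> variants \<tau> xs. sat \<rho> \<phi>})"
    by (intro SUP_cong[OF refl]) (clarsimp split: prod.splits)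
  then show ?case unfolding eval.simps by (rule arg_cong)
next
  case (Var x)
  have "\<sigma> x = \<tau> x" by (rule Var.prems) simp
  then show ?case unfolding eval.simps by (rule arg_cong)
qed


section \<open>Presentations\<close>

text \<open>A pair \<open>(e, \<sigma>)\<close>, where the valuation \<open>\<sigma>\<close> of the free variables of \<open>e\<close> is given by its
  graph.\<close>

type_synonym 'a pres = "expr \<times> (var \<times> 'a) list"

definition is_pres :: "'a pres \<Rightarrow> bool" where
  "is_pres = (\<lambda>(e, \<rho>). distinct (map fst \<rho>) \<and> set (map fst \<rho>) = fv e)"

text \<open>Outside \<open>fv e\<close> the valuation used here is arbitrary, which is harmless by \<open>eval_cong\<close>.\<close>

definition val :: "'a pres \<Rightarrow> 'a hset" where
  "val = (\<lambda>(e, \<rho>). eval e (\<lambda>x. the (map_of \<rho> x)))"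

fun code_fm :: "fm \<Rightarrow> nat" where
  "code_fm (FEq x y) = prod_encode (0, prod_encode (x, y))"
| "code_fm (FNeg \<phi>) = prod_encode (1, code_fm \<phi>)"
| "code_fm (FConj \<phi> \<psi>) = prod_encode (2, prod_encode (code_fm \<phi>, code_fm \<psi>))"
| "code_fm (FEx x \<phi>) = prod_encode (3, prod_encode (x, code_fm \<phi>))"

fun code_expr :: "expr \<Rightarrow> nat" where
  "code_expr (Var x) = prod_encode (0, x)"
| "code_expr (FUnion bs) = prod_encode (1, list_encode
     (map (\<lambda>(e, xs, \<phi>). prod_encode (code_expr e, prod_encode (list_encode xs, code_fm \<phi>))) bs))"

text \<open>The parameter \<open>c\<close> is the numbering of the atoms.\<close>

definition code_pres :: "('a \<Rightarrow> nat) \<Rightarrow> 'a pres \<Rightarrow> nat" where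
  "code_pres c = (\<lambda>(e, \<rho>).
     prod_encode (code_expr e, list_encode (map (\<lambda>(x, a). prod_encode (x, c a)) \<rho>)))"

lemma code_fm_inject: "code_fm \<phi> = code_fm \<psi> \<Longrightarrow> \<phi> = \<psi>"
proof (induction \<phi> arbitrary: \<psi>)
  case (FEq x y) then show ?case by (cases \<psi>) auto
next
  case (FNeg \<phi>) then show ?case by (cases \<psi>) auto
next
  case (FConj \<phi>1 \<phi>2) then show ?case by (cases \<psi>) auto
next
  case (FEx x \<phi>) then show ?case by (cases \<psi>) auto
qed

lemma code_expr_inject: "code_expr e = code_expr e' \<Longrightarrow> e = e'"
proof (induction e arbitrary: e')
  case (Var x) then show ?case by (cases e') auto
next
  case (FUnion bs)
  let ?h = "\<lambda>(e, xs, \<phi>). prod_encode (code_expr e, prod_encode (list_encode xs, code_fm \<phi>))"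
  obtain bs' where e': "e' = FUnion bs'" and eq: "map ?h bs = map ?h bs'"
    using FUnion.prems by (cases e') (auto simp: list_encode_eq)
  have inj: "b = b'" if b: "b \<in> set bs" and h: "?h b = ?h b'" for b b'
  proof -
    obtain e xs \<phi> e' xs' \<phi>' where bb': "b = (e, xs, \<phi>)" "b' = (e', xs', \<phi>')"
      by (cases b; cases b')
    have "code_expr e = code_expr e'" "xs = xs'" "code_fm \<phi> = code_fm \<phi>'"
      using h by (simp_all add: bb' list_encode_eq)
    moreover from this(1) have "e = e'"
      using b by (intro FUnion.IH[of b e]) (simp_all add: bb')
    ultimately show ?thesis using code_fm_inject bb' by simp
  qed
  have "bs = bs'"
  proof (rule nth_equalityI)
    show len: "length bs = length bs'" using eq by (rule map_eq_imp_length_eq)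
    show "bs ! i = bs' ! i" if "i < length bs" for i
    proof (rule inj)
      show "bs ! i \<in> set bs" using that by simp
      have "map ?h bs ! i = map ?h bs' ! i" by (simp only: eq)
      then show "?h (bs ! i) = ?h (bs' ! i)" using that len by (simp only: nth_map)
    qed
  qed
  then show ?case using e' by simp
qed

lemma inj_code_pres:
  assumes "inj c"
  shows "inj (code_pres c)"
proof (rule injI)
  fix p q :: "'a pres"
  assume eq: "code_pres c p = code_pres c q"
  have "inj (\<lambda>(x :: var, a). prod_encode (x, c a))"
    using assms by (auto simp: inj_def)
  then have "inj (map (\<lambda>(x :: var, a). prod_encode (x, c a)))" by (rule inj_mapI)
  note inj_map = injD[OF this]
  obtain e \<rho> e' \<rho>' where pq: "p = (e, \<rho>)" "q = (e', \<rho>')"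
    by (cases p; cases q)
  have "code_expr e = code_expr e'"
    "map (\<lambda>(x, a). prod_encode (x, c a)) \<rho> = map (\<lambda>(x, a). prod_encode (x, c a)) \<rho>'"
    using eq by (simp_all add: code_pres_def pq list_encode_eq)
  then show "p = q"
    unfolding pq by (intro arg_cong2[of _ _ _ _ Pair] code_expr_inject inj_map)
qed


section \<open>Decidability\<close>

text \<open>Total recursive functions, as the closure of the basic functions under composition, primitive
  recursion and regular minimization. Arguments are passed as a list; missing arguments are read
  as \<open>0\<close> and superfluous ones are ignored.\<close>

definition arg_at :: "nat list \<Rightarrow> nat \<Rightarrow> nat" where
  "arg_at xs i = (if i < length xs then xs ! i else 0)"

inductive recursive :: "(nat list \<Rightarrow> nat) \<Rightarrow> bool" where
  zero: "recursive (\<lambda>xs. 0)"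
| succ: "recursive (\<lambda>xs. Suc (arg_at xs 0))"
| proj: "recursive (\<lambda>xs. arg_at xs i)"
| comp: "recursive g \<Longrightarrow> (\<And>f. f \<in> set fs \<Longrightarrow> recursive f) \<Longrightarrow>
     recursive (\<lambda>xs. g (map (\<lambda>f. f xs) fs))"
| prec: "recursive f \<Longrightarrow> recursive g \<Longrightarrow>
     recursive (\<lambda>xs. rec_nat (f (tl xs)) (\<lambda>y r. g (y # r # tl xs)) (arg_at xs 0))"
| mini: "recursive f \<Longrightarrow> (\<And>xs. \<exists>y. f (y # xs) = 0) \<Longrightarrow>
     recursive (\<lambda>xs. LEAST y. f (y # xs) = 0)"

text \<open>Decidability of a problem \<open>P\<close> whose instances \<open>I\<close> are presented to the algorithm via the
  encoding \<open>enc\<close>; nothing is required of the answer on inputs that do not encode an instance.\<close>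

definition decidable :: "('i \<Rightarrow> nat) \<Rightarrow> 'i set \<Rightarrow> ('i \<Rightarrow> bool) \<Rightarrow> bool" where
  "decidable enc I P \<longleftrightarrow>
     (\<exists>f. recursive f \<and> (\<forall>i\<in>I. f [enc i] = (if P i then 1 else 0)))"


section \<open>Set covering\<close>

definition set_family_on :: "'a hset \<Rightarrow> 'a hset \<Rightarrow> bool" where
  "set_family_on X \<S> \<longleftrightarrow> is_set X \<and> is_set \<S> \<and> (\<forall>Y\<in>elems \<S>. is_set Y \<and> elems Y \<subseteq> elems X)"

definition has_finite_cover :: "'a hset \<Rightarrow> 'a hset \<Rightarrow> bool" where
  "has_finite_cover X \<S> \<longleftrightarrow> (\<exists>C \<subseteq> elems \<S>. finite C \<and> (\<Union>Y\<in>C. elems Y) = elems X)"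

definition set_covering_instances :: "('a pres \<times> 'a pres) set" where
  "set_covering_instances =
     {(p, q). is_pres p \<and> is_pres q \<and> set_family_on (val p) (val q)}"

definition code_instance :: "('a \<Rightarrow> nat) \<Rightarrow> 'a pres \<times> 'a pres \<Rightarrow> nat" where
  "code_instance c = (\<lambda>(p, q). prod_encode (code_pres c p, code_pres c q))"

end

theory Submission imports Defs begin

text \<open>A finite subfamily of \<open>\<S>\<close> mentions only finitely many atoms. Fix a finite set \<open>T\<close> of atoms that
  contains the parameters of the instance and enough others. If a finite cover exists, then already
  the members of \<open>\<S>\<close> whose valuations take values in \<open>T\<close> cover \<open>X\<close>: given an element \<open>x\<close>, permute its
  atoms outside \<open>T\<close> away from the atoms of the cover, pick a member of the cover that contains the
  image, permute back, and then permute the atoms of this member into \<open>T\<close> without touching those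
  of \<open>x\<close>. As only finitely many members have valuations in \<open>T\<close>, it remains to decide whether these
  cover \<open>X\<close>.

  By the same kind of permutation, all quantifiers and set-builder variables may range over a finite
  set of atoms that is large compared with the code of the instance. The truth of a formula and
  the equality of two values are then certified by a finite set of facts, each of which is justified
  by other facts about smaller formulas or expressions; the size of such a certificate is bounded, so
  that it can be found by bounded search.\<close>

section \<open>Recursive functions\<close>

lemma arg_at_0 [simp]: "arg_at (x # xs) 0 = x"
  and arg_at_Suc [simp]: "arg_at (x # xs) (Suc i) = arg_at xs i"
  and arg_at_tl: "arg_at (tl xs) i = arg_at xs (Suc i)"
  by (cases xs; simp add: arg_at_def)+

lemma recursive_comp1:
  assumes "recursive (\<lambda>xs. g (arg_at xs 0))" "recursive a"
  shows "recursive (\<lambda>xs. g (a xs))"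
  using recursive.comp[OF assms(1), of "[a]"] assms(2) by simp

lemma recursive_comp2:
  assumes "recursive (\<lambda>xs. g (arg_at xs 0) (arg_at xs 1))" "recursive a" "recursive b"
  shows "recursive (\<lambda>xs. g (a xs) (b xs))"
  using recursive.comp[OF assms(1), of "[a, b]"] assms(2,3) by fastforce

lemma recursive_Suc: "recursive a \<Longrightarrow> recursive (\<lambda>xs. Suc (a xs))"
  by (rule recursive_comp1[OF recursive.succ])

lemma recursive_const: "recursive (\<lambda>xs. k)"
  by (induction k) (auto intro: recursive.zero recursive_Suc)

lemma recursive_rec_nat:
  assumes f: "recursive (\<lambda>xs. f (arg_at xs 0))"
    and g: "recursive (\<lambda>xs. g (arg_at xs 0) (arg_at xs 1) (arg_at xs 2))"
    and n: "recursive n" and p: "recursive p"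
  shows "recursive (\<lambda>xs. rec_nat (f (p xs)) (\<lambda>y r. g y r (p xs)) (n xs))"
proof -
  have "recursive (\<lambda>xs. rec_nat (f (arg_at xs 1)) (\<lambda>y r. g y r (arg_at xs 1)) (arg_at xs 0))"
    using recursive.prec[OF f g] by (simp add: arg_at_tl numeral_2_eq_2)
  from recursive_comp2[OF this n p] show ?thesis .
qed

lemma recursive_add:
  assumes "recursive a" "recursive b"
  shows "recursive (\<lambda>xs. a xs + b xs)"
proof -
  have "rec_nat n (\<lambda>_. Suc) m = m + n" for m n by (induction m) auto
  with recursive_rec_nat[of "\<lambda>x. x" "\<lambda>_ r _. Suc r",
      OF recursive.proj recursive_Suc, OF recursive.proj assms]
  show ?thesis by simp
qed

lemma recursive_mult:
  assumes "recursive a" "recursive b"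
  shows "recursive (\<lambda>xs. a xs * b xs)"
proof -
  have "rec_nat 0 (\<lambda>_ r. r + n) m = m * n" for m n :: nat by (induction m) auto
  with recursive_rec_nat[of "\<lambda>x. 0" "\<lambda>_ r p. r + p", OF recursive_const recursive_add,
      OF recursive.proj recursive.proj assms]
  show ?thesis by simp
qed

lemma recursive_power:
  assumes "recursive a" "recursive b"
  shows "recursive (\<lambda>xs. a xs ^ b xs)"
proof -
  have "rec_nat 1 (\<lambda>_ r. r * n) m = n ^ m" for m n :: nat by (induction m) auto
  with recursive_rec_nat[of "\<lambda>x. 1" "\<lambda>_ r p. r * p", OF recursive_const recursive_mult,
      OF recursive.proj recursive.proj assms(2,1)]
  show ?thesis by simp
qed

lemma recursive_diff:
  assumes "recursive a" "recursive b"
  shows "recursive (\<lambda>xs. a xs - b xs)"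
proof -
  have "rec_nat 0 (\<lambda>y _. y) m = m - 1" for m by (cases m) auto
  with recursive_rec_nat[of "\<lambda>x. 0" "\<lambda>y _ _. y", OF recursive_const recursive.proj
      recursive.proj recursive.proj]
  have pred: "recursive (\<lambda>xs. arg_at xs i - 1)" for i by simp
  have "rec_nat n (\<lambda>_ r. r - 1) m = n - m" for m n :: nat by (induction m) auto
  with recursive_rec_nat[of "\<lambda>x. x" "\<lambda>_ r p. r - 1", OF recursive.proj pred assms(2,1)]
  show ?thesis by simp
qed

lemma recursive_triangle:
  assumes "recursive a"
  shows "recursive (\<lambda>xs. triangle (a xs))"
proof -
  have "rec_nat 0 (\<lambda>y r. r + Suc y) m = triangle m" for m by (induction m) auto
  with recursive_rec_nat[of "\<lambda>x. 0" "\<lambda>y r p. r + Suc y",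
      OF recursive_const recursive_add assms assms, OF recursive.proj recursive_Suc, OF recursive.proj]
  show ?thesis by simp
qed

lemma recursive_prod_encode:
  "recursive a \<Longrightarrow> recursive b \<Longrightarrow> recursive (\<lambda>xs. prod_encode (a xs, b xs))"
  unfolding prod_encode_def prod.case by (intro recursive_add recursive_triangle)

text \<open>From here on several arguments are packed into one with \<open>prod_encode\<close>, so that a variable
  bound inside an expression extends the environment \<open>p\<close> to a pair.\<close>

definition rec1 :: "(nat \<Rightarrow> nat) \<Rightarrow> bool" where
  "rec1 f \<longleftrightarrow> recursive (\<lambda>xs. f (arg_at xs 0))"

definition recp :: "(nat \<Rightarrow> bool) \<Rightarrow> bool" where
  "recp P \<longleftrightarrow> rec1 (\<lambda>p. of_bool (P p))"

definition pfst :: "nat \<Rightarrow> nat" where "pfst n = fst (prod_decode n)"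
definition psnd :: "nat \<Rightarrow> nat" where "psnd n = snd (prod_decode n)"

lemma pfst_encode [simp]: "pfst (prod_encode (x, y)) = x"
  and psnd_encode [simp]: "psnd (prod_encode (x, y)) = y"
  by (simp_all add: pfst_def psnd_def)

lemma prod_encode_pfst_psnd [simp]: "prod_encode (pfst n, psnd n) = n"
  by (simp add: pfst_def psnd_def)

lemma pfst_le: "pfst n \<le> n" and psnd_le: "psnd n \<le> n"
  using le_prod_encode_1[of "pfst n" "psnd n"] le_prod_encode_2[of "psnd n" "pfst n"] by simp_all

lemma triangle_mono: "m \<le> n \<Longrightarrow> triangle m \<le> triangle n"
  by (induction rule: dec_induct) auto

text \<open>The pairs with sum \<open>s\<close> are numbered by the interval from
  \<open>triangle s\<close> up to, but excluding, \<open>triangle (Suc s)\<close>. The search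
  therefore finds the antidiagonal of the pair, and \<open>x\<close> is the offset within
  it.\<close>

lemma diagonal_encode: "(LEAST s. prod_encode (x, y) < triangle (Suc s)) = x + y"
proof (rule Least_equality)
  fix s assume "prod_encode (x, y) < triangle (Suc s)"
  then show "x + y \<le> s"
    using triangle_mono[of "Suc s" "x + y"] by (fastforce simp: prod_encode_def not_le[symmetric])
qed (simp add: prod_encode_def)

lemma rec1_pfst_psnd: "rec1 pfst" "rec1 psnd"
proof -
  define d where "d n = (LEAST s. n < triangle (Suc s))" for n
  \<comment> \<open>Truncated subtraction yields \<open>0\<close> exactly when the input lies below
    \<open>triangle (Suc s)\<close>. The search variable is argument \<open>0\<close>, the input is
    argument \<open>1\<close>.\<close>
  have "recursive (\<lambda>xs. LEAST s. Suc (arg_at (s # xs) 1) - triangle (Suc (arg_at (s # xs) 0)) = 0)"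
  proof (rule recursive.mini)
    fix xs
    have "n \<le> triangle n" for n by (induction n) auto
    then show "\<exists>s. Suc (arg_at (s # xs) 1) - triangle (Suc (arg_at (s # xs) 0)) = 0"
      using le_trans[of _ "Suc (arg_at xs 0)"] by (intro exI[of _ "arg_at xs 0"]) simp
  qed (intro recursive_diff recursive_Suc recursive_triangle recursive.proj)
  then have d: "recursive (\<lambda>xs. d (arg_at xs 0))" by (simp add: d_def Suc_le_eq del: triangle_Suc)
  have eqs: "pfst n = n - triangle (d n)" "psnd n = d n - (n - triangle (d n))" for n
  proof -
    obtain x y where "n = prod_encode (x, y)" by (metis prod_encode_pfst_psnd)
    moreover from this have "d n = x + y" by (simp add: d_def diagonal_encode del: triangle_Suc)
    ultimately show "pfst n = n - triangle (d n)" "psnd n = d n - (n - triangle (d n))"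
      by (simp_all, simp_all add: prod_encode_def)
  qed
  show "rec1 pfst" "rec1 psnd"
    unfolding rec1_def eqs by (intro recursive_diff recursive_triangle recursive.proj d)+
qed

lemma rec1_comp: "rec1 g \<Longrightarrow> rec1 f \<Longrightarrow> rec1 (\<lambda>p. g (f p))"
  unfolding rec1_def by (rule recursive_comp1)

lemma rec1_pfst: "rec1 f \<Longrightarrow> rec1 (\<lambda>p. pfst (f p))"
  and rec1_psnd: "rec1 f \<Longrightarrow> rec1 (\<lambda>p. psnd (f p))"
  by (rule rec1_comp[OF rec1_pfst_psnd(1)] rec1_comp[OF rec1_pfst_psnd(2)]; assumption)+

lemma rec1_const: "rec1 (\<lambda>p. k)" and rec1_id: "rec1 (\<lambda>p. p)"
  and rec1_Suc: "rec1 f \<Longrightarrow> rec1 (\<lambda>p. Suc (f p))"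
  and rec1_add: "rec1 f \<Longrightarrow> rec1 g \<Longrightarrow> rec1 (\<lambda>p. f p + g p)"
  and rec1_mult: "rec1 f \<Longrightarrow> rec1 g \<Longrightarrow> rec1 (\<lambda>p. f p * g p)"
  and rec1_diff: "rec1 f \<Longrightarrow> rec1 g \<Longrightarrow> rec1 (\<lambda>p. f p - g p)"
  and rec1_power: "rec1 f \<Longrightarrow> rec1 g \<Longrightarrow> rec1 (\<lambda>p. f p ^ g p)"
  and rec1_prod_encode: "rec1 f \<Longrightarrow> rec1 g \<Longrightarrow> rec1 (\<lambda>p. prod_encode (f p, g p))"
  unfolding rec1_def
  by (intro recursive_const recursive.proj recursive_Suc recursive_add recursive_mult
      recursive_diff recursive_power recursive_prod_encode; assumption)+

lemma rec1_comp2: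
  assumes "rec1 (\<lambda>p. g (pfst p) (psnd p))" "rec1 a" "rec1 b"
  shows "rec1 (\<lambda>p. g (a p) (b p))"
  using rec1_comp[OF assms(1) rec1_prod_encode[OF assms(2,3)]] by simp

lemma rec1_rec_nat:
  assumes f: "rec1 f" and n: "rec1 n"
    and g: "rec1 (\<lambda>q. g (pfst q) (pfst (psnd q)) (psnd (psnd q)))"
  shows "rec1 (\<lambda>p. rec_nat (f p) (\<lambda>y r. g y r p) (n p))"
proof -
  have "recursive (\<lambda>xs. prod_encode (arg_at xs 0, prod_encode (arg_at xs 1, arg_at xs 2)))"
    by (intro recursive_prod_encode recursive.proj)
  from recursive_comp1[OF g[unfolded rec1_def] this]
  have "recursive (\<lambda>xs. g (arg_at xs 0) (arg_at xs 1) (arg_at xs 2))" by simp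
  from recursive_rec_nat[OF f[unfolded rec1_def] this n[unfolded rec1_def] recursive.proj]
  show ?thesis by (simp add: rec1_def)
qed

lemma rec1_Least:
  assumes f: "rec1 (\<lambda>q. f (pfst q) (psnd q))" and ex: "\<And>p. \<exists>y. f y p = 0"
  shows "rec1 (\<lambda>p. LEAST y. f y p = 0)"
proof -
  have "recursive (\<lambda>xs. prod_encode (arg_at xs 0, arg_at xs 1))"
    by (intro recursive_prod_encode recursive.proj)
  from recursive_comp1[OF f[unfolded rec1_def] this]
  have "recursive (\<lambda>xs. f (arg_at xs 0) (arg_at xs 1))" by simp
  from recursive.mini[OF this] ex show ?thesis by (simp add: rec1_def)
qed

lemma rec1_div:
  assumes "rec1 f" "rec1 g"
  shows "rec1 (\<lambda>p. f p div g p)"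
proof -
  \<comment> \<open>The quotient is the least \<open>q\<close> with \<open>a < Suc q * b\<close>.
    The outer factor \<open>b\<close> stops the search at \<open>0\<close> when
    \<open>b = 0\<close>, in agreement with the value of division by zero.\<close>
  have eq: "a div b = (LEAST q. (Suc a - Suc q * b) * b = 0)" for a b :: nat
  proof (cases "b = 0")
    case False
    have "(LEAST q. (Suc a - Suc q * b) * b = 0) = a div b"
    proof (rule Least_equality)
      show "(Suc a - Suc (a div b) * b) * b = 0"
        using dividend_less_times_div[of b a] False by (simp add: mult.commute)
      show "a div b \<le> q" if "(Suc a - Suc q * b) * b = 0" for q
        using that False by (simp add: Suc_le_eq div_less_iff_less_mult less_Suc_eq_le[symmetric])
    qed
    then show ?thesis by simp
  qed simp
  have "rec1 (\<lambda>p. LEAST q. (Suc (pfst p) - Suc q * psnd p) * psnd p = 0)"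
  proof (rule rec1_Least)
    show "\<exists>y. (Suc (pfst p) - Suc y * psnd p) * psnd p = 0" for p
      by (cases "psnd p") (auto intro!: exI[of _ "pfst p"])
  qed (intro rec1_mult rec1_diff rec1_Suc rec1_pfst rec1_psnd rec1_id)
  then have "rec1 (\<lambda>p. pfst p div psnd p)" by (simp add: eq)
  from rec1_comp2[OF this assms] show ?thesis .
qed

lemma rec1_mod: "rec1 f \<Longrightarrow> rec1 g \<Longrightarrow> rec1 (\<lambda>p. f p mod g p)"
  unfolding modulo_nat_def by (intro rec1_diff rec1_mult rec1_div)

section \<open>Decidable predicates and bounded quantifiers\<close>

lemma recp_const: "recp (\<lambda>p. b)"
  unfolding recp_def by (rule rec1_const)

lemma recp_not:
  assumes "recp P"
  shows "recp (\<lambda>p. \<not> P p)"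
proof -
  have eq: "of_bool (\<not> b) = (1 :: nat) - of_bool b" for b by simp
  show ?thesis using assms unfolding recp_def eq by (intro rec1_diff rec1_const)
qed

lemma recp_conj: "recp P \<Longrightarrow> recp Q \<Longrightarrow> recp (\<lambda>p. P p \<and> Q p)"
  unfolding recp_def of_bool_conj by (rule rec1_mult)

lemma recp_disj: "recp P \<Longrightarrow> recp Q \<Longrightarrow> recp (\<lambda>p. P p \<or> Q p)"
  using recp_not[OF recp_conj[OF recp_not recp_not]] by simp

lemma recp_imp: "recp P \<Longrightarrow> recp Q \<Longrightarrow> recp (\<lambda>p. P p \<longrightarrow> Q p)"
  unfolding imp_conv_disj by (intro recp_disj recp_not)

lemma recp_le:
  assumes "rec1 f" "rec1 g"
  shows "recp (\<lambda>p. f p \<le> g p)"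
proof -
  have "of_bool (m \<le> n) = 1 - (m - n)" for m n :: nat by auto
  then show ?thesis unfolding recp_def by (simp only:) (intro rec1_diff rec1_const assms)
qed

lemma recp_less: "rec1 f \<Longrightarrow> rec1 g \<Longrightarrow> recp (\<lambda>p. f p < g p)"
  unfolding not_le[symmetric] by (intro recp_not recp_le)

lemma recp_eq: "rec1 f \<Longrightarrow> rec1 g \<Longrightarrow> recp (\<lambda>p. f p = (g p :: nat))"
  unfolding order.eq_iff by (intro recp_conj recp_le)

lemma recp_comp2:
  assumes "recp (\<lambda>p. P (pfst p) (psnd p))" "rec1 a" "rec1 b"
  shows "recp (\<lambda>p. P (a p) (b p))"
  using assms rec1_comp2[of "\<lambda>x y. of_bool (P x y)"] by (simp add: recp_def)

text \<open>Primitive recursion on the bound accumulates the disjunction of the instances in a truth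
  value \<open>r\<close>.\<close>

lemma recp_ex:
  assumes n: "rec1 n" and P: "recp (\<lambda>q. P (pfst q) (psnd q))"
  shows "recp (\<lambda>p. \<exists>x < n p. P x p)"
proof -
  have "rec_nat (0 :: nat) (\<lambda>y r. of_bool (P y p \<or> r = 1)) m = of_bool (\<exists>x < m. P x p)" for p m
    by (induction m) (auto simp: less_Suc_eq)
  moreover have "rec1 (\<lambda>p. rec_nat 0 (\<lambda>y r. of_bool (P y p \<or> r = 1)) (n p))"
    by (intro rec1_rec_nat n rec1_const recp_disj[unfolded recp_def] recp_eq[unfolded recp_def]
        recp_comp2[OF P, unfolded recp_def] rec1_pfst rec1_psnd rec1_id)
  ultimately show ?thesis by (simp only: recp_def)
qed

lemma recp_all:
  assumes "rec1 n" "recp (\<lambda>q. P (pfst q) (psnd q))"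
  shows "recp (\<lambda>p. \<forall>x < n p. P x p)"
  using recp_not[OF recp_ex[OF assms(1) recp_not[OF assms(2)]]] by simp

text \<open>A nonempty list has as code the successor of a pair of its head and the code of its
  tail. For \<open>n = 0\<close> both sides are the empty list, as truncated subtraction and
  \<open>psnd\<close> leave \<open>0\<close> unchanged.\<close>

lemma list_decode_tl: "list_decode (psnd (n - 1)) = tl (list_decode n)"
  using psnd_le[of 0] by (cases n) (auto simp: psnd_def split: prod.split)

text \<open>Membership becomes a bounded search over positions: \<open>dr i n\<close> is the code of
  the list without its first \<open>i\<close> entries, and a list is never longer than its
  code.\<close>

lemma recp_in_list:
  assumes "rec1 f" "rec1 g"
  shows "recp (\<lambda>p. f p \<in> set (list_decode (g p)))"
proof -
  define dr where "dr i n = rec_nat n (\<lambda>_ r. psnd (r - 1)) i" for i n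
  have dr: "list_decode (dr i n) = drop i (list_decode n)" for i n
    unfolding dr_def by (induction i) (simp_all add: list_decode_tl drop_Suc tl_drop del: One_nat_def)
  have len: "length (list_decode n) \<le> n" for n
  proof (induction n rule: less_induct)
    case (less n)
    show ?case
    proof (cases n)
      case (Suc m)
      then show ?thesis using less[of "psnd m"] psnd_le[of m]
        by (auto simp: psnd_def split: prod.split)
    qed simp
  qed
  have iff: "x \<in> set (list_decode n) \<longleftrightarrow> (\<exists>i < n. dr i n \<noteq> 0 \<and> x = pfst (dr i n - 1))" for x n
  proof -
    have hd: "pfst (m - 1) = hd (list_decode m)" if "m \<noteq> 0" for m
      using that by (cases m) (auto simp: pfst_def split: prod.split)
    have nz: "dr i n \<noteq> 0 \<longleftrightarrow> i < length (list_decode n)" for i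
    proof -
      have "dr i n = 0 \<longleftrightarrow> list_decode (dr i n) = []"
        by (metis list_decode.simps(1) list_decode_inverse list_encode.simps(1))
      then show ?thesis by (simp add: dr not_le)
    qed
    have "dr i n \<noteq> 0 \<and> x = pfst (dr i n - 1) \<longleftrightarrow>
        i < length (list_decode n) \<and> x = list_decode n ! i" for i
      using hd[of "dr i n"] nz[of i] by (auto simp: dr hd_drop_conv_nth)
    then have "(\<exists>i < n. dr i n \<noteq> 0 \<and> x = pfst (dr i n - 1)) \<longleftrightarrow>
      (\<exists>i < length (list_decode n). x = list_decode n ! i)"
      using len[of n] by (simp only:) (auto intro: less_le_trans)
    then show ?thesis by (auto simp: in_set_conv_nth)
  qed
  have dr1: "rec1 (\<lambda>p. dr (a p) (b p))" if "rec1 a" "rec1 b" for a b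
    unfolding dr_def by (intro rec1_rec_nat that rec1_psnd rec1_pfst rec1_diff rec1_const rec1_id)
  have "recp (\<lambda>p. pfst p \<in> set (list_decode (psnd p)))"
    unfolding iff by (intro recp_ex recp_conj recp_not recp_eq dr1 rec1_pfst rec1_psnd rec1_diff rec1_const rec1_id)
  from recp_comp2[OF this assms] show ?thesis .
qed

lemma recp_in_set:
  assumes "rec1 f" "rec1 g"
  shows "recp (\<lambda>p. f p \<in> set_decode (g p))"
  unfolding set_decode_def mem_Collect_eq odd_iff_mod_2_eq_one
  by (intro recp_eq rec1_mod rec1_div rec1_power rec1_const assms)

text \<open>These rules follow the syntax of a predicate whose quantifiers are all bounded, so that
  its decidability is proved by \<open>intro\<close>.\<close>

lemmas rec_intros = recp_const recp_not recp_conj recp_disj recp_imp recp_le recp_less recp_eq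
  recp_ex recp_all recp_in_list recp_in_set rec1_const rec1_id rec1_Suc rec1_add rec1_mult
  rec1_diff rec1_power rec1_div rec1_mod rec1_prod_encode rec1_pfst rec1_psnd

section \<open>Equivariance\<close>

text \<open>Injectivity preserves equality in both directions, and surjectivity makes every witness
  of a quantifier an image under the permutation.\<close>

lemma sat_bij:
  assumes "bij \<pi>"
  shows "sat (\<pi> \<circ> \<sigma>) \<phi> \<longleftrightarrow> sat \<sigma> \<phi>"
proof (induction \<phi> arbitrary: \<sigma>)
  case (FEq x y)
  then show ?case using bij_is_inj[OF assms] by (simp add: inj_eq)
next
  case (FEx x \<phi>)
  have "(\<pi> \<circ> \<sigma>)(x := \<pi> a) = \<pi> \<circ> \<sigma>(x := a)" for a by auto
  then have "sat ((\<pi> \<circ> \<sigma>)(x := \<pi> a)) \<phi> \<longleftrightarrow> sat (\<sigma>(x := a)) \<phi>" for a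
    using FEx.IH[of "\<sigma>(x := a)"] by (simp only:)
  moreover have "(\<exists>a. P a) \<longleftrightarrow> (\<exists>a. P (\<pi> a))" for P
    using bij_is_surj[OF assms] by (metis surjD)
  ultimately show ?case by (simp only: sat.simps)
qed auto

lemma variants_bij:
  assumes "bij \<pi>"
  shows "variants (\<pi> \<circ> \<sigma>) xs = (\<lambda>\<tau>. \<pi> \<circ> \<tau>) ` variants \<sigma> xs"
proof
  show "variants (\<pi> \<circ> \<sigma>) xs \<subseteq> (\<lambda>\<tau>. \<pi> \<circ> \<tau>) ` variants \<sigma> xs"
  proof
    fix \<tau> assume "\<tau> \<in> variants (\<pi> \<circ> \<sigma>) xs"
    then have "inv \<pi> \<circ> \<tau> \<in> variants \<sigma> xs" and "\<tau> = \<pi> \<circ> (inv \<pi> \<circ> \<tau>)"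
      using assms by (auto simp: variants_def fun_eq_iff bij_is_inj bij_is_surj surj_f_inv_f)
    then show "\<tau> \<in> (\<lambda>\<tau>. \<pi> \<circ> \<tau>) ` variants \<sigma> xs" by blast
  qed
qed (auto simp: variants_def)

lemma elems_map_hset: "elems (map_hset f v) = map_hset f ` elems v"
  by (cases v) (simp_all add: cimage.rep_eq)

text \<open>Expressions contain no atoms of their own: atoms enter a value through the valuation or
  as all possible values of a bound variable, and a permutation only rearranges the latter.\<close>

lemma eval_bij:
  fixes \<pi> :: "'a \<Rightarrow> 'a"
  assumes countable: "countable (UNIV :: 'a set)" and \<pi>: "bij \<pi>"
  shows "eval e (\<pi> \<circ> \<sigma>) = map_hset \<pi> (eval e \<sigma>)"
proof (induction e arbitrary: \<sigma>)
  case (FUnion bs)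
  have IH: "eval e (\<pi> \<circ> \<tau>) = map_hset \<pi> (eval e \<tau>)" if "(e, xs, \<phi>) \<in> set bs" for e xs \<phi> \<tau>
    by (rule FUnion.IH[OF that]) simp
  have "elems (eval (FUnion bs) (\<pi> \<circ> \<sigma>)) =
    {eval e (\<pi> \<circ> \<tau>) | e xs \<phi> \<tau>. (e, xs, \<phi>) \<in> set bs \<and> \<tau> \<in> variants \<sigma> xs \<and> sat \<tau> \<phi>}"
    unfolding elems_eval_FUnion[OF countable] variants_bij[OF \<pi>] using sat_bij[OF \<pi>] by blast
  also have "\<dots> = {map_hset \<pi> (eval e \<tau>) | e xs \<phi> \<tau>. (e, xs, \<phi>) \<in> set bs \<and> \<tau> \<in> variants \<sigma> xs \<and> sat \<tau> \<phi>}"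
    using IH by (intro Collect_cong) metis
  also have "\<dots> = elems (map_hset \<pi> (eval (FUnion bs) \<sigma>))"
    unfolding elems_map_hset elems_eval_FUnion[OF countable] image_Collect
    by (intro Collect_cong) metis
  finally show ?case by (simp add: rcset_inject del: comp_apply)
qed simp

text \<open>The atoms assigned to the free variables support the value.\<close>

lemma map_hset_fixed:
  fixes \<pi> :: "'a \<Rightarrow> 'a"
  assumes "countable (UNIV :: 'a set)" "bij \<pi>" "\<And>x. x \<in> fv e \<Longrightarrow> \<pi> (\<sigma> x) = \<sigma> x"
  shows "map_hset \<pi> (eval e \<sigma>) = eval e \<sigma>"
  unfolding eval_bij[OF assms(1,2), symmetric] by (rule eval_cong) (simp add: assms(3))

text \<open>Elements of \<open>E\<close> outside \<open>U\<close> are swapped with distinct elements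
  of \<open>U\<close> that lie in neither \<open>E\<close> nor \<open>F\<close>. The inclusion of
  \<open>E \<inter> F\<close> in \<open>U\<close> keeps \<open>F\<close> out of the swap, and the
  cardinality condition provides enough partners.\<close>

lemma bij_moving_into:
  assumes "finite U" "finite E" "finite F" and "E \<inter> F \<subseteq> U" and "card E + card F \<le> card U"
  obtains \<pi> :: "'a \<Rightarrow> 'a" where "bij \<pi>" "\<And>a. a \<in> F \<Longrightarrow> \<pi> a = a" "\<pi> ` E \<subseteq> U"
proof -
  have "card (E - U) \<le> card (U - (E \<union> F))"
  proof -
    have "card (E \<union> F) \<le> card U" using card_Un_le[of E F] assms(5) by simp
    moreover have "card (E \<union> F) = card (E \<union> F - U) + card (U \<inter> (E \<union> F))"
      using assms(2,3) by (metis Int_commute card_Diff_subset_Int card_Int_Diff finite_UnI add.commute)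
    moreover have "card U = card (U - (E \<union> F)) + card (U \<inter> (E \<union> F))"
      using assms(1) by (metis card_Int_Diff add.commute)
    moreover have "card (E - U) \<le> card (E \<union> F - U)"
      using assms(2,3) by (intro card_mono) auto
    ultimately show ?thesis by linarith
  qed
  then obtain g where g: "g ` (E - U) \<subseteq> U - (E \<union> F)" "inj_on g (E - U)"
    using assms card_le_inj[of "E - U" "U - (E \<union> F)"] by auto
  define Q where "Q = g ` (E - U)"
  define h where "h = inv_into (E - U) g"
  \<comment> \<open>Built from disjoint transpositions, \<open>\<pi>\<close> is an involution and
    hence a bijection.\<close>
  define \<pi> where "\<pi> a = (if a \<in> E - U then g a else if a \<in> Q then h a else a)" for a
  have Q: "Q \<inter> (E \<union> F) = {}" "Q \<subseteq> U" using g(1) by (auto simp: Q_def)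
  have gQ: "g a \<in> Q" "h (g a) = a" if "a \<in> E - U" for a
    using that g(2) by (auto simp: Q_def h_def)
  have hQ: "h a \<in> E - U" "g (h a) = a" if "a \<in> Q" for a
    using that inv_into_into[of a g "E - U"] f_inv_into_f[of a g "E - U"]
    unfolding Q_def h_def by blast+
  have "\<pi> (\<pi> a) = a" for a
    using gQ[of a] hQ[of a] Q(2) by (auto simp: \<pi>_def)
  then have "bij \<pi>" by (rule involuntory_imp_bij)
  moreover have "\<pi> a = a" if "a \<in> F" for a
    using that Q(1) assms(4) by (auto simp: \<pi>_def)
  moreover have "\<pi> ` E \<subseteq> U"
    using gQ(1) Q by (auto simp: \<pi>_def)
  ultimately show ?thesis by (rule that)
qed

section \<open>Sizes of codes\<close>

lemma prod_encode_mono: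
  "x \<le> x' \<Longrightarrow> y \<le> y' \<Longrightarrow> prod_encode (x, y) \<le> prod_encode (x', y')"
  by (simp add: prod_encode_def add_mono triangle_mono)

lemma list_encode_member_less: "x \<in> set xs \<Longrightarrow> x < list_encode xs"
proof (induction xs)
  case (Cons a xs)
  then show ?case
    using le_prod_encode_1[of a "list_encode xs"] le_prod_encode_2[of "list_encode xs" a] by auto
qed simp

lemma le_prod_encode: "x \<le> a \<Longrightarrow> x \<le> prod_encode (a, b)" "x \<le> b \<Longrightarrow> x \<le> prod_encode (a, b)"
  by (blast intro: le_prod_encode_1 le_prod_encode_2 order.trans)+

text \<open>A bound on the code thus bounds the variables as well, so a finite table of digits
  determines the truth value.\<close>

lemma fv_fm_le_code: "x \<in> fv_fm \<phi> \<Longrightarrow> x \<le> code_fm \<phi>"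
  by (induction \<phi>) (auto intro: le_prod_encode)

definition code_branch :: "expr \<times> var list \<times> fm \<Rightarrow> nat" where
  "code_branch = (\<lambda>(e, xs, \<phi>). prod_encode (code_expr e, prod_encode (list_encode xs, code_fm \<phi>)))"

lemma code_expr_FUnion: "code_expr (FUnion bs) = prod_encode (1, list_encode (map code_branch bs))"
  by (simp add: code_branch_def)

text \<open>Strictness makes inductions on codes descend from a union to the expressions in its
  branches.\<close>

lemma code_branch_less: "b \<in> set bs \<Longrightarrow> code_branch b < code_expr (FUnion bs)"
  unfolding code_expr_FUnion
  by (rule less_le_trans[OF list_encode_member_less le_prod_encode_2]) simp

lemma code_branch_components:
  "code_expr e \<le> code_branch (e, xs, \<phi>)" "code_fm \<phi> \<le> code_branch (e, xs, \<phi>)"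
  by (auto simp: code_branch_def intro: le_prod_encode)

lemma fv_le_code: "x \<in> fv e \<Longrightarrow> x \<le> code_expr e"
proof (induction e)
  case (FUnion bs)
  then obtain e xs \<phi> where b: "(e, xs, \<phi>) \<in> set bs" and x: "x \<in> fv e \<or> x \<in> fv_fm \<phi>" by auto
  then have "x \<le> code_branch (e, xs, \<phi>)"
    using FUnion.IH[OF b] fv_fm_le_code[of x \<phi>] code_branch_components by (fastforce intro: order.trans)
  also have "\<dots> < code_expr (FUnion bs)" by (rule code_branch_less[OF b])
  finally show ?case by simp
qed (simp add: le_prod_encode_2)

section \<open>The decision procedure\<close>

text \<open>A valuation of the variables below \<open>L\<close> in the atoms numbered below \<open>N\<close> is represented by a
  number below \<open>N ^ L\<close>, whose digits in base \<open>N\<close> are the numbers of the atoms.\<close>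

definition digit :: "nat \<Rightarrow> nat \<Rightarrow> nat \<Rightarrow> nat" where
  "digit N s x = s div N ^ x mod N"

text \<open>Here \<open>v\<close> encodes a list of variables.\<close>

definition agree_off :: "nat \<Rightarrow> nat \<Rightarrow> nat \<Rightarrow> nat \<Rightarrow> nat \<Rightarrow> bool" where
  "agree_off N L v s t \<longleftrightarrow> (\<forall>y<L. y \<in> set (list_decode v) \<or> digit N s y = digit N t y)"

text \<open>A finite set of facts is represented by a bit set \<open>W\<close>. A fact says that a formula does not
  hold (\<open>0\<close>), that a formula holds (\<open>1\<close>), or that two expressions have the same value (\<open>2\<close>),
  under valuations that are part of the fact.\<close>

definition fact_fm :: "nat \<Rightarrow> nat \<Rightarrow> nat \<Rightarrow> nat \<Rightarrow> bool" where
  "fact_fm W b f s \<longleftrightarrow> prod_encode (b, prod_encode (f, s)) \<in> set_decode W"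

definition fact_eq :: "nat \<Rightarrow> nat \<Rightarrow> nat \<Rightarrow> nat \<Rightarrow> nat \<Rightarrow> bool" where
  "fact_eq W e s e' s' \<longleftrightarrow>
    prod_encode (2, prod_encode (prod_encode (e, s), prod_encode (e', s'))) \<in> set_decode W"

text \<open>The case distinction on \<open>pfst f\<close> follows the tags of
  \<open>code_fm\<close>. Falsity has facts of its own, so each clause only asks for the presence of
  other facts. \<open>Suc (prod_encode (x, 0))\<close> is the code of the list
  \<open>[x]\<close>.\<close>

definition justified_fm :: "nat \<Rightarrow> nat \<Rightarrow> nat \<Rightarrow> bool" where
  "justified_fm N L W \<longleftrightarrow> (\<forall>f<L. \<forall>s<N ^ L.
     (fact_fm W 1 f s \<longrightarrow>
        (pfst f = 0 \<longrightarrow> digit N s (pfst (psnd f)) = digit N s (psnd (psnd f))) \<and>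
        (pfst f = 1 \<longrightarrow> fact_fm W 0 (psnd f) s) \<and>
        (pfst f = 2 \<longrightarrow> fact_fm W 1 (pfst (psnd f)) s \<and> fact_fm W 1 (psnd (psnd f)) s) \<and>
        (pfst f = 3 \<longrightarrow> (\<exists>t<N ^ L. agree_off N L (Suc (prod_encode (pfst (psnd f), 0))) s t \<and>
           fact_fm W 1 (psnd (psnd f)) t))) \<and>
     (fact_fm W 0 f s \<longrightarrow>
        (pfst f = 0 \<longrightarrow> digit N s (pfst (psnd f)) \<noteq> digit N s (psnd (psnd f))) \<and>
        (pfst f = 1 \<longrightarrow> fact_fm W 1 (psnd f) s) \<and>
        (pfst f = 2 \<longrightarrow> fact_fm W 0 (pfst (psnd f)) s \<or> fact_fm W 0 (psnd (psnd f)) s) \<and>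
        (pfst f = 3 \<longrightarrow> (\<forall>t<N ^ L. agree_off N L (Suc (prod_encode (pfst (psnd f), 0))) s t \<longrightarrow>
           fact_fm W 0 (psnd (psnd f)) t))))"

text \<open>Inclusion between the values of two unions, unfolded into branches: every choice that is
  not certified to violate its guard has a certified equal partner on the other side.\<close>

definition fact_incl :: "nat \<Rightarrow> nat \<Rightarrow> nat \<Rightarrow> nat \<Rightarrow> nat \<Rightarrow> nat \<Rightarrow> nat \<Rightarrow> bool" where
  "fact_incl N L W e s e' s' \<longleftrightarrow>
    (\<forall>b<L. b \<in> set (list_decode (psnd e)) \<longrightarrow>
      (\<forall>t<N ^ L. agree_off N L (pfst (psnd b)) s t \<longrightarrow> fact_fm W 0 (psnd (psnd b)) t \<or>
        (\<exists>b'<L. b' \<in> set (list_decode (psnd e')) \<and>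
          (\<exists>t'<N ^ L. agree_off N L (pfst (psnd b')) s' t' \<and> fact_fm W 1 (psnd (psnd b')) t' \<and>
            fact_eq W (pfst b) t (pfst b') t'))))"

definition justified_eq :: "nat \<Rightarrow> nat \<Rightarrow> nat \<Rightarrow> bool" where
  "justified_eq N L W \<longleftrightarrow> (\<forall>e<L. \<forall>e'<L. \<forall>s<N ^ L. \<forall>s'<N ^ L. fact_eq W e s e' s' \<longrightarrow>
     (pfst e = 0 \<longrightarrow> pfst e' = 0 \<and> digit N s (psnd e) = digit N s' (psnd e')) \<and>
     (pfst e = 1 \<longrightarrow> pfst e' = 1 \<and> fact_incl N L W e s e' s' \<and> fact_incl N L W e' s' e s))"

text \<open>Here \<open>r\<close> encodes the graph of the given valuation. Keeping all digits below
  \<open>L\<close> places every parameter among the first \<open>L\<close> atoms.\<close>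

definition extends :: "nat \<Rightarrow> nat \<Rightarrow> nat \<Rightarrow> nat \<Rightarrow> bool" where
  "extends N L r s \<longleftrightarrow> (\<forall>x<L. digit N s x < L) \<and>
     (\<forall>b<L. b \<in> set (list_decode r) \<longrightarrow> digit N s (pfst b) = psnd b)"

text \<open>The digits of \<open>t'\<close> below \<open>3 * L\<close> restrict the members of the
  family to finitely many; the first \<open>3 * L\<close> atoms form the finite set
  \<open>T\<close>.\<close>

definition fact_cover :: "nat \<Rightarrow> nat \<Rightarrow> nat \<Rightarrow> nat \<Rightarrow> nat \<Rightarrow> nat \<Rightarrow> nat \<Rightarrow> bool" where
  "fact_cover N L W e s e' s' \<longleftrightarrow>
    (\<forall>b<L. b \<in> set (list_decode (psnd e)) \<longrightarrow>
      (\<forall>t<N ^ L. agree_off N L (pfst (psnd b)) s t \<longrightarrow> fact_fm W 0 (psnd (psnd b)) t \<or>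
        (\<exists>b'<L. b' \<in> set (list_decode (psnd e')) \<and>
          (\<exists>t'<N ^ L. agree_off N L (pfst (psnd b')) s' t' \<and> fact_fm W 1 (psnd (psnd b')) t' \<and>
            (\<forall>x<L. digit N t' x < 3 * L) \<and>
            (\<exists>d<L. d \<in> set (list_decode (psnd (pfst b'))) \<and>
              (\<exists>u<N ^ L. agree_off N L (pfst (psnd d)) t' u \<and> fact_fm W 1 (psnd (psnd d)) u \<and>
                fact_eq W (pfst b) t (pfst d) u))))))"

text \<open>The number \<open>k\<close> dominates the tags, the codes below \<open>L\<close> and the
  valuations below \<open>N ^ L\<close>. By monotonicity of pairing every relevant fact lies below
  the bound, and a set of such facts lies below the corresponding power of two.\<close>

definition fact_bound :: "nat \<Rightarrow> nat \<Rightarrow> nat" where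
  "fact_bound N L = (let k = N ^ L + L + 2 in
     Suc (prod_encode (k, prod_encode (prod_encode (k, k), prod_encode (k, k)))))"

definition certified_cover :: "nat \<Rightarrow> nat \<Rightarrow> nat \<Rightarrow> bool" where
  "certified_cover N L n \<longleftrightarrow> (\<exists>W<2 ^ fact_bound N L. justified_fm N L W \<and> justified_eq N L W \<and>
     (\<exists>s<N ^ L. extends N L (psnd (pfst n)) s \<and> (\<exists>s'<N ^ L. extends N L (psnd (psnd n)) s' \<and>
        fact_cover N L W (pfst (pfst n)) s (pfst (psnd n)) s')))"

text \<open>Every quantifier is bounded by a recursive function of \<open>n\<close>. The bound
  \<open>Suc n\<close> exceeds all codes, variables and atom numbers that occur in an instance with
  code \<open>n\<close>.\<close>

lemma recp_certified_cover: "recp (\<lambda>n. certified_cover (4 * Suc n) (Suc n) n)"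
  unfolding certified_cover_def fact_bound_def Let_def extends_def fact_cover_def justified_eq_def
    fact_incl_def justified_fm_def fact_eq_def fact_fm_def agree_off_def digit_def
  by (intro rec_intros)

section \<open>Correctness of certificates\<close>

text \<open>Horner's scheme: the induction splits off the least significant digit.\<close>

lemma ex_digits:
  assumes "\<And>x. x < L \<Longrightarrow> g x < N"
  shows "\<exists>s<N ^ L. \<forall>x<L. digit N s x = g x"
  using assms
proof (induction L arbitrary: g)
  case (Suc L)
  from Suc.IH[of "\<lambda>x. g (Suc x)"] Suc.prems
  obtain s where s: "s < N ^ L" "\<forall>x<L. digit N s x = g (Suc x)" by auto
  have g0: "g 0 < N" using Suc.prems by simp
  have "digit N (g 0 + N * s) x = g x" if "x < Suc L" for x
  proof (cases x)
    case 0
    then show ?thesis using g0 by (simp add: digit_def)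
  next
    case (Suc y)
    have "(g 0 + N * s) div N ^ Suc y = s div N ^ y"
      using g0 by (simp add: div_mult2_eq)
    then show ?thesis using that s(2) Suc by (simp add: digit_def)
  qed
  moreover have "g 0 + N * s < N ^ Suc L"
  proof -
    have "g 0 + N * s < N * Suc s" using g0 by simp
    also have "\<dots> \<le> N * N ^ L" using s(1) by (intro mult_left_mono) auto
    finally show ?thesis by simp
  qed
  ultimately show ?case by blast
qed simp

lemma digit_beyond: "s < N ^ L \<Longrightarrow> L \<le> x \<Longrightarrow> digit N s x = 0"
proof -
  assume s: "s < N ^ L" and x: "L \<le> x"
  show "digit N s x = 0"
  proof (cases "N = 0")
    case False
    then have "N ^ L \<le> N ^ x" using x by (simp add: power_increasing)
    then show ?thesis using s by (simp add: digit_def)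
  qed (use s x in \<open>auto simp: digit_def power_0_left split: if_splits\<close>)
qed

declare eval.simps [simp del] code_expr.simps(2) [simp del]

text \<open>\<open>L\<close> bounds codes and variables, \<open>N\<close> is the number of atoms in
  use. The factor \<open>4\<close> leaves room for \<open>L\<close> atoms to be moved and up to
  \<open>3 * L\<close> atoms to be kept fixed.\<close>

locale coding =
  fixes c :: "'a \<Rightarrow> nat" and L N :: nat
  assumes bij: "bij c" and L: "0 < L" and N: "N = 4 * L"
begin

lemma countable_atoms: "countable (UNIV :: 'a set)"
  using bij by (auto intro: countableI[of c] dest: bij_is_inj)

lemma infinite_atoms: "infinite (UNIV :: 'a set)"
  using bij bij_betw_finite infinite_UNIV_nat by blast

lemmas elems_FUnion = elems_eval_FUnion[OF countable_atoms]

section \<open>Valuations given by digits\<close>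

definition atoms :: "nat \<Rightarrow> 'a set" where
  "atoms m = inv c ` {..<m}"

definition vl :: "nat \<Rightarrow> var \<Rightarrow> 'a" where
  "vl s x = inv c (digit N s x)"

abbreviation B :: nat where "B \<equiv> N ^ L"

lemma inv_c [simp]: "c (inv c k) = k" "inv c (c a) = a"
  using bij by (simp_all add: bij_is_surj surj_f_inv_f bij_is_inj)

lemma inv_c_eq [simp]: "inv c k = inv c l \<longleftrightarrow> k = l"
  by (metis inv_c(1))

lemma mem_atoms: "a \<in> atoms m \<longleftrightarrow> c a < m"
  unfolding atoms_def by (metis image_iff inv_c lessThan_iff)

lemma atoms_finite [simp]: "finite (atoms m)" and card_atoms [simp]: "card (atoms m) = m"
  by (auto simp: atoms_def card_image inj_on_def)

lemma digit_less: "digit N s x < N"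
  using L N by (simp add: digit_def)

lemma vl_eq [simp]: "vl s x = vl t y \<longleftrightarrow> digit N s x = digit N t y"
  by (simp add: vl_def)

lemma vl_atoms: "vl s x \<in> atoms m \<longleftrightarrow> digit N s x < m"
  by (simp add: mem_atoms vl_def)

lemma agree_off_iff:
  assumes "s < B" "t < B"
  shows "agree_off N L (list_encode xs) s t \<longleftrightarrow> vl t \<in> variants (vl s) xs"
proof
  assume *: "agree_off N L (list_encode xs) s t"
  have "digit N t y = digit N s y" if "y \<notin> set xs" for y
    using * that digit_beyond[OF assms(1), of y] digit_beyond[OF assms(2), of y]
    by (cases "y < L") (auto simp: agree_off_def)
  then show "vl t \<in> variants (vl s) xs" by (simp add: variants_def)
qed (auto simp: agree_off_def variants_def)

lemma ex_vl:
  assumes "\<And>x. x < L \<Longrightarrow> \<tau> x \<in> atoms m" "m \<le> N"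
  shows "\<exists>t<B. \<forall>x<L. vl t x = \<tau> x"
proof -
  have "c (\<tau> x) < N" if "x < L" for x
    using assms(1)[OF that] assms(2) by (simp add: mem_atoms)
  from ex_digits[of L "\<lambda>x. c (\<tau> x)", OF this] show ?thesis by (auto simp: vl_def)
qed

lemma sat_vl_cong: "code_fm \<phi> < L \<Longrightarrow> (\<And>x. x < L \<Longrightarrow> \<sigma> x = \<tau> x) \<Longrightarrow> sat \<sigma> \<phi> \<longleftrightarrow> sat \<tau> \<phi>"
  by (rule sat_cong) (meson fv_fm_le_code le_less_trans)

lemma eval_vl_cong: "code_expr e < L \<Longrightarrow> (\<And>x. x < L \<Longrightarrow> \<sigma> x = \<tau> x) \<Longrightarrow> eval e \<sigma> = eval e \<tau>"
  by (rule eval_cong) (meson fv_le_code le_less_trans)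

lemma fixed_value:
  fixes \<pi> :: "'a \<Rightarrow> 'a"
  assumes "code_expr e < L" "bij \<pi>" "\<And>x. x < L \<Longrightarrow> \<pi> (\<sigma> x) = \<sigma> x"
  shows "map_hset \<pi> (eval e \<sigma>) = eval e \<sigma>"
  using assms(1) fv_le_code[of _ e]
  by (intro map_hset_fixed[OF countable_atoms assms(2)] assms(3)) (meson le_less_trans)

lemma card_range_le: "card (\<tau> ` {..<L}) \<le> L"
  using card_image_le[of "{..<L}" \<tau>] by simp

text \<open>The \<open>L\<close> values of \<open>\<tau>\<close> that matter are moved into the
  first \<open>N\<close> atoms while \<open>F\<close> stays fixed. As \<open>F\<close> contains the
  values of \<open>vl s\<close>, the result is still a variant of \<open>vl s\<close>.\<close>

lemma move_into_code:
  assumes F: "F \<subseteq> atoms N" "card F \<le> 3 * L" and \<tau>: "\<tau> \<in> variants (vl s) xs" "s < B" "vl s ` {..<L} \<subseteq> F"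
  obtains \<pi> t where "bij \<pi>" "\<And>a. a \<in> F \<Longrightarrow> \<pi> a = a" "t < B" "vl t \<in> variants (vl s) xs"
    "\<And>\<phi>. code_fm \<phi> < L \<Longrightarrow> sat (vl t) \<phi> \<longleftrightarrow> sat \<tau> \<phi>"
    "\<And>e. code_expr e < L \<Longrightarrow> eval e (vl t) = map_hset \<pi> (eval e \<tau>)"
proof -
  have "finite F" using F(1) finite_subset atoms_finite by blast
  then obtain \<pi> where \<pi>: "bij \<pi>" "\<And>a. a \<in> F \<Longrightarrow> \<pi> a = a" "\<pi> ` \<tau> ` {..<L} \<subseteq> atoms N"
    using bij_moving_into[of "atoms N" "\<tau> ` {..<L}" F] F card_range_le[of \<tau>] N by auto
  then obtain t where t: "t < B" "\<forall>x<L. vl t x = \<pi> (\<tau> x)"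
    using ex_vl[of "\<lambda>x. \<pi> (\<tau> x)" N] by (auto simp: image_subset_iff)
  have "vl t x = vl s x" if "x \<notin> set xs" for x
  proof (cases "x < L")
    case True
    then show ?thesis using that \<tau> t(2) \<pi>(2)[of "vl s x"] by (auto simp: variants_def simp del: vl_eq)
  next
    case False
    then show ?thesis using digit_beyond[OF t(1), of x] digit_beyond[OF \<tau>(2), of x] by simp
  qed
  then have "vl t \<in> variants (vl s) xs" by (simp add: variants_def del: vl_eq)
  moreover have "sat (vl t) \<phi> \<longleftrightarrow> sat \<tau> \<phi>" if "code_fm \<phi> < L" for \<phi>
    using sat_vl_cong[OF that, of "vl t" "\<pi> \<circ> \<tau>"] t(2) sat_bij[OF \<pi>(1)] by simp
  moreover have "eval e (vl t) = map_hset \<pi> (eval e \<tau>)" if "code_expr e < L" for e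
    using eval_vl_cong[OF that, of "vl t" "\<pi> \<circ> \<tau>"] t(2) eval_bij[OF countable_atoms \<pi>(1)] by simp
  ultimately show ?thesis using that \<pi> t(1) by blast
qed

lemma vl_subset: "vl s ` X \<subseteq> atoms N"
  using digit_less by (auto simp: vl_atoms)

text \<open>Taking for \<open>F\<close> the values of both \<open>vl s\<close> and
  \<open>vl r\<close>, at most \<open>2 * L\<close> atoms, also fixes everything evaluated under
  \<open>vl r\<close>.\<close>

lemma move_into_code_fixing:
  assumes "\<tau> \<in> variants (vl s) xs" "s < B"
  obtains \<pi> t where "bij \<pi>" "t < B" "vl t \<in> variants (vl s) xs"
    "\<And>\<phi>. code_fm \<phi> < L \<Longrightarrow> sat (vl t) \<phi> \<longleftrightarrow> sat \<tau> \<phi>"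
    "\<And>e. code_expr e < L \<Longrightarrow> eval e (vl t) = map_hset \<pi> (eval e \<tau>)"
    "\<And>e. code_expr e < L \<Longrightarrow> map_hset \<pi> (eval e (vl r)) = eval e (vl r)"
proof -
  define F where "F = vl s ` {..<L} \<union> vl r ` {..<L}"
  have "F \<subseteq> atoms N" using vl_subset by (auto simp: F_def)
  moreover have "card F \<le> 3 * L"
    using card_Un_le[of "vl s ` {..<L}" "vl r ` {..<L}"] card_range_le[of "vl s"]
      card_range_le[of "vl r"]
    by (simp add: F_def)
  moreover have "vl s ` {..<L} \<subseteq> F" by (simp add: F_def)
  ultimately obtain \<pi> t where *: "bij \<pi>" "\<And>a. a \<in> F \<Longrightarrow> \<pi> a = a" "t < B" "vl t \<in> variants (vl s) xs"
    "\<And>\<phi>. code_fm \<phi> < L \<Longrightarrow> sat (vl t) \<phi> \<longleftrightarrow> sat \<tau> \<phi>"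
    "\<And>e. code_expr e < L \<Longrightarrow> eval e (vl t) = map_hset \<pi> (eval e \<tau>)"
    using move_into_code[OF _ _ assms] by metis
  have "map_hset \<pi> (eval e (vl r)) = eval e (vl r)" if "code_expr e < L" for e
    using *(2) by (intro fixed_value[OF that *(1)]) (auto simp: F_def)
  then show ?thesis using that * by blast
qed

section \<open>Quantifiers and membership restricted to finitely many atoms\<close>

lemma sat_FEx_vl:
  assumes "code_fm (FEx x \<phi>) < L" "s < B"
  shows "sat (vl s) (FEx x \<phi>) \<longleftrightarrow> (\<exists>t<B. agree_off N L (list_encode [x]) s t \<and> sat (vl t) \<phi>)"
proof
  have \<phi>: "code_fm \<phi> < L" using assms(1) le_prod_encode[of "code_fm \<phi>"]
    by (metis code_fm.simps(4) le_less_trans le_prod_encode_2)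
  assume "sat (vl s) (FEx x \<phi>)"
  then obtain a where a: "sat ((vl s)(x := a)) \<phi>" by auto
  have "(vl s)(x := a) \<in> variants (vl s) [x]" by (simp add: variants_def)
  \<comment> \<open>A witness may be any atom; a permutation fixing the values of
    \<open>vl s\<close> brings it among the first \<open>N\<close>.\<close>
  then obtain t where "t < B" "vl t \<in> variants (vl s) [x]" "sat (vl t) \<phi>"
    using move_into_code_fixing[of "(vl s)(x := a)" s "[x]"] assms(2) \<phi> a by metis
  then show "\<exists>t<B. agree_off N L (list_encode [x]) s t \<and> sat (vl t) \<phi>"
    using agree_off_iff[OF assms(2)] by blast
next
  assume "\<exists>t<B. agree_off N L (list_encode [x]) s t \<and> sat (vl t) \<phi>"
  then obtain t where "vl t \<in> variants (vl s) [x]" "sat (vl t) \<phi>" using agree_off_iff[OF assms(2)]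
    by blast
  moreover from this(1) have "vl t = (vl s)(x := vl t x)"
    by (auto simp: variants_def simp del: vl_eq)
  ultimately show "sat (vl s) (FEx x \<phi>)" by (metis sat.simps(4))
qed

text \<open>The semantic counterpart of \<open>fact_incl\<close>, with truth in place of certified
  facts.\<close>

definition incl_vl :: "(expr \<times> var list \<times> fm) list \<Rightarrow> nat \<Rightarrow>
  (expr \<times> var list \<times> fm) list \<Rightarrow> nat \<Rightarrow> bool" where
  "incl_vl bs s bs' s' \<longleftrightarrow> (\<forall>(e, xs, \<phi>) \<in> set bs. \<forall>t<B. agree_off N L (list_encode xs) s t \<longrightarrow>
    \<not> sat (vl t) \<phi> \<or>
     (\<exists>(e', xs', \<phi>') \<in> set bs'. \<exists>t'<B. agree_off N L (list_encode xs') s' t' \<and> sat (vl t') \<phi>' \<and>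
       eval e (vl t) = eval e' (vl t')))"

lemma branch_less_L:
  assumes "code_expr (FUnion bs) < L" "(e, xs, \<phi>) \<in> set bs"
  shows "code_branch (e, xs, \<phi>) < L" "code_expr e < L" "code_fm \<phi> < L"
  using code_branch_less[OF assms(2)] assms(1) code_branch_components[where e = e and xs = xs and
    \<phi> = \<phi>] by simp_all

text \<open>A witnessing valuation is moved into the first \<open>N\<close> atoms by a permutation
  that fixes the value of \<open>e\<close> under \<open>vl t\<close>, so the equation between the
  two values survives.\<close>

lemma mem_FUnion_vl:
  assumes e: "code_expr e < L" and bs: "code_expr (FUnion bs) < L" and t: "t < B" and s: "s < B"
  shows "eval e (vl t) \<in> elems (eval (FUnion bs) (vl s)) \<longleftrightarrow>
    (\<exists>(e', xs', \<phi>') \<in> set bs. \<exists>t'<B. agree_off N L (list_encode xs') s t' \<and> sat (vl t') \<phi>' \<and>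
      eval e (vl t) = eval e' (vl t'))"
proof
  assume "eval e (vl t) \<in> elems (eval (FUnion bs) (vl s))"
  then obtain e' xs' \<phi>' \<tau> where b: "(e', xs', \<phi>') \<in> set bs" and
    \<tau>: "\<tau> \<in> variants (vl s) xs'" "sat \<tau> \<phi>'" "eval e (vl t) = eval e' \<tau>"
    unfolding elems_FUnion by blast
  obtain \<pi> t' where p: "t' < B" "vl t' \<in> variants (vl s) xs'"
    "\<And>\<phi>. code_fm \<phi> < L \<Longrightarrow> sat (vl t') \<phi> \<longleftrightarrow> sat \<tau> \<phi>"
    "\<And>e. code_expr e < L \<Longrightarrow> eval e (vl t') = map_hset \<pi> (eval e \<tau>)"
    "\<And>e. code_expr e < L \<Longrightarrow> map_hset \<pi> (eval e (vl t)) = eval e (vl t)"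
    using move_into_code_fixing[OF \<tau>(1) s, of t] by metis
  have "eval e (vl t) = eval e' (vl t')"
    using p(4)[of e'] p(5)[OF e] branch_less_L[OF bs b] \<tau>(3) by simp
  moreover have "sat (vl t') \<phi>'" using p(3) \<tau>(2) branch_less_L[OF bs b] by simp
  moreover have "agree_off N L (list_encode xs') s t'" using agree_off_iff[OF s p(1)] p(2) by simp
  ultimately show "\<exists>(e', xs', \<phi>') \<in> set bs. \<exists>t'<B. agree_off N L (list_encode xs') s t' \<and>
    sat (vl t') \<phi>' \<and> eval e (vl t) = eval e' (vl t')"
    using p(1) by (intro bexI[OF _ b]) auto
next
  assume "\<exists>(e', xs', \<phi>') \<in> set bs. \<exists>t'<B. agree_off N L (list_encode xs') s t' \<and> sat (vl t') \<phi>' \<and>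
    eval e (vl t) = eval e' (vl t')"
  then show "eval e (vl t) \<in> elems (eval (FUnion bs) (vl s))"
    unfolding elems_FUnion using agree_off_iff[OF s] by blast
qed

text \<open>An arbitrary element of the left set is moved to one given by digits, by a permutation
  that fixes the right set. Membership is then pulled back by injectivity.\<close>

lemma incl_vl_iff:
  assumes bs: "code_expr (FUnion bs) < L" "code_expr (FUnion bs') < L" and s: "s < B" "s' < B"
  shows "incl_vl bs s bs' s' \<longleftrightarrow> elems (eval (FUnion bs) (vl s)) \<subseteq> elems (eval (FUnion bs') (vl s'))"
proof
  assume incl: "incl_vl bs s bs' s'"
  show "elems (eval (FUnion bs) (vl s)) \<subseteq> elems (eval (FUnion bs') (vl s'))"
  proof
    fix v assume "v \<in> elems (eval (FUnion bs) (vl s))"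
    then obtain e xs \<phi> \<tau> where b: "(e, xs, \<phi>) \<in> set bs" and
      \<tau>: "\<tau> \<in> variants (vl s) xs" "sat \<tau> \<phi>" "v = eval e \<tau>"
      unfolding elems_FUnion by blast
    obtain \<pi> t where p: "bij \<pi>" "t < B" "vl t \<in> variants (vl s) xs"
      "\<And>\<phi>. code_fm \<phi> < L \<Longrightarrow> sat (vl t) \<phi> \<longleftrightarrow> sat \<tau> \<phi>"
      "\<And>e. code_expr e < L \<Longrightarrow> eval e (vl t) = map_hset \<pi> (eval e \<tau>)"
      "\<And>e. code_expr e < L \<Longrightarrow> map_hset \<pi> (eval e (vl s')) = eval e (vl s')"
      using move_into_code_fixing[OF \<tau>(1) s(1), of s'] by metis
    note e = branch_less_L[OF bs(1) b]
    have "eval e (vl t) \<in> elems (eval (FUnion bs') (vl s'))"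
      unfolding mem_FUnion_vl[OF e(2) bs(2) p(2) s(2)]
      using bspec[OF incl[unfolded incl_vl_def] b] p(2,3) p(4)[OF e(3)] \<tau>(2)
        agree_off_iff[OF s(1) p(2), of xs] by simp
    then have "map_hset \<pi> v \<in> map_hset \<pi> ` elems (eval (FUnion bs') (vl s'))"
      using p(6)[OF bs(2)] p(5)[OF e(2)] \<tau>(3) by (simp flip: elems_map_hset)
    moreover have "inj (map_hset \<pi>)"
      using p(1) by (simp add: hset.inj_map bij_is_inj)
    ultimately show "v \<in> elems (eval (FUnion bs') (vl s'))" by (simp add: inj_image_mem_iff)
  qed
next
  assume sub: "elems (eval (FUnion bs) (vl s)) \<subseteq> elems (eval (FUnion bs') (vl s'))"
  show "incl_vl bs s bs' s'"
    unfolding incl_vl_def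
  proof (unfold disj_imp not_not, clarify)
    fix e xs \<phi> t
    assume b: "(e, xs, \<phi>) \<in> set bs" and t: "t < B" "agree_off N L (list_encode xs) s t" "sat (vl t) \<phi>"
    then have "eval e (vl t) \<in> elems (eval (FUnion bs) (vl s))"
      unfolding elems_FUnion using agree_off_iff[OF s(1)] by blast
    with sub show "\<exists>(e', xs', \<phi>') \<in> set bs'. \<exists>t'<B. agree_off N L (list_encode xs') s' t' \<and>
      sat (vl t') \<phi>' \<and> eval e (vl t) = eval e' (vl t')"
      using mem_FUnion_vl[OF branch_less_L(2)[OF bs(1) b] bs(2) t(1) s(2)] by blast
  qed
qed

section \<open>Reading branches from codes\<close>

lemma list_decode_code_FUnion: "set (list_decode (psnd (code_expr (FUnion bs)))) = code_branch ` set bs"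
  by (simp add: code_expr_FUnion)

lemma pfst_code_expr: "pfst (code_expr (Var x)) = 0" "pfst (code_expr (FUnion bs)) = 1"
  by (simp_all add: code_expr_FUnion)

text \<open>Branch codes are smaller than the code of the union, so the bounded quantifier reaches
  every branch.\<close>

lemma ball_branches:
  assumes "code_expr (FUnion bs) < L"
  shows "(\<forall>b<L. b \<in> set (list_decode (psnd (code_expr (FUnion bs)))) \<longrightarrow> P b) \<longleftrightarrow>
    (\<forall>(e, xs, \<phi>) \<in> set bs. P (code_branch (e, xs, \<phi>)))"
proof -
  have "code_branch b < L" if "b \<in> set bs" for b using code_branch_less[OF that] assms by simp
  then show ?thesis unfolding list_decode_code_FUnion by auto
qed

lemma bex_branches:
  assumes "code_expr (FUnion bs) < L"
  shows "(\<exists>b<L. b \<in> set (list_decode (psnd (code_expr (FUnion bs)))) \<and> P b) \<longleftrightarrow>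
    (\<exists>(e, xs, \<phi>) \<in> set bs. P (code_branch (e, xs, \<phi>)))"
  using ball_branches[OF assms, of "\<lambda>b. \<not> P b"] by auto

lemma code_branch_projections:
  "pfst (code_branch (e, xs, \<phi>)) = code_expr e"
  "pfst (psnd (code_branch (e, xs, \<phi>))) = list_encode xs"
  "psnd (psnd (code_branch (e, xs, \<phi>))) = code_fm \<phi>"
  by (simp_all add: code_branch_def)

lemma fact_incl_code:
  assumes "code_expr (FUnion bs) < L" "code_expr (FUnion bs') < L"
  shows "fact_incl N L W (code_expr (FUnion bs)) s (code_expr (FUnion bs')) s' \<longleftrightarrow>
    (\<forall>(e, xs, \<phi>) \<in> set bs. \<forall>t<B. agree_off N L (list_encode xs) s t \<longrightarrow> fact_fm W 0 (code_fm \<phi>) t \<or>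
     (\<exists>(e', xs', \<phi>') \<in> set bs'. \<exists>t'<B. agree_off N L (list_encode xs') s' t' \<and>
       fact_fm W 1 (code_fm \<phi>') t' \<and>
        fact_eq W (code_expr e) t (code_expr e') t'))"
  unfolding fact_incl_def ball_branches[OF assms(1)] bex_branches[OF assms(2)] code_branch_projections
  by (rule refl)

section \<open>Soundness of certificates\<close>

lemma fm_code_less:
  "code_fm (FNeg \<phi>) < L \<Longrightarrow> code_fm \<phi> < L"
  "code_fm (FConj \<phi> \<psi>) < L \<Longrightarrow> code_fm \<phi> < L \<and> code_fm \<psi> < L"
  "code_fm (FEx x \<phi>) < L \<Longrightarrow> code_fm \<phi> < L"
  by (auto simp: le_prod_encode elim!: le_less_trans[rotated])

text \<open>Both kinds of facts are treated in one induction because negation exchanges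
  them.\<close>

lemma justified_fm_sound:
  assumes J: "justified_fm N L W" and "code_fm \<phi> < L" "s < B"
  shows "(fact_fm W 1 (code_fm \<phi>) s \<longrightarrow> sat (vl s) \<phi>) \<and> (fact_fm W 0 (code_fm \<phi>) s \<longrightarrow> \<not> sat (vl s) \<phi>)"
  using assms(2,3)
proof (induction \<phi> arbitrary: s)
  case (FEq x y)
  from J[unfolded justified_fm_def, rule_format, OF FEq] show ?case by simp
next
  case (FNeg \<phi>)
  from J[unfolded justified_fm_def, rule_format, OF FNeg.prems]
    FNeg.IH[OF fm_code_less(1)[OF FNeg.prems(1)] FNeg.prems(2)]
  show ?case by auto
next
  case (FConj \<phi> \<psi>)
  note less = fm_code_less(2)[OF FConj.prems(1)]
  from J[unfolded justified_fm_def, rule_format, OF FConj.prems] FConj.IH(1)[OF _ FConj.prems(2)]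
    FConj.IH(2)[OF _ FConj.prems(2)] less
  show ?case by auto
next
  case (FEx x \<phi>)
  note less = fm_code_less(3)[OF FEx.prems(1)]
  have code: "list_encode [x] = Suc (prod_encode (x, 0))" by simp
  from J[unfolded justified_fm_def, rule_format, OF FEx.prems] FEx.IH[OF less]
  show ?case unfolding sat_FEx_vl[OF FEx.prems] code by auto
qed

lemma eval_FUnion_eqI:
  "elems (eval (FUnion bs) \<sigma>) = elems (eval (FUnion bs') \<sigma>') \<Longrightarrow>
    eval (FUnion bs) \<sigma> = eval (FUnion bs') \<sigma>'"
  by (simp add: eval.simps rcset_inject)

text \<open>The induction is on the sum of the two codes, a measure that is symmetric and so serves
  the inclusions in both directions.\<close>

lemma justified_eq_sound:
  assumes J: "justified_fm N L W" "justified_eq N L W"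
    and "code_expr e < L" "code_expr e' < L" "s < B" "s' < B"
      "fact_eq W (code_expr e) s (code_expr e') s'"
  shows "eval e (vl s) = eval e' (vl s')"
  using assms(3-)
proof (induction "code_expr e + code_expr e'" arbitrary: e e' s s' rule: less_induct)
  case less
  note less_L = less.prems(1,2)
  from J(2)[unfolded justified_eq_def, rule_format, OF less.prems]
  have just: "pfst (code_expr e) = 0 \<longrightarrow> pfst (code_expr e') = 0 \<and>
    digit N s (psnd (code_expr e)) = digit N s' (psnd (code_expr e'))"
    "pfst (code_expr e) = 1 \<longrightarrow> pfst (code_expr e') = 1 \<and>
      fact_incl N L W (code_expr e) s (code_expr e') s' \<and>
      fact_incl N L W (code_expr e') s' (code_expr e) s"
    by blast+
  show ?case
  proof (cases e)
    case (Var x)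
    then show ?thesis using just(1) by (cases e') (auto simp: pfst_code_expr eval.simps)
  next
    case e: (FUnion bs)
    show ?thesis
    proof (cases e')
      case (Var x)
      then show ?thesis using just(2) e by (simp add: pfst_code_expr)
    next
      case e': (FUnion bs')
      have incl: "incl_vl bs1 s1 bs2 s2"
        if fact: "fact_incl N L W (code_expr (FUnion bs1)) s1 (code_expr (FUnion bs2)) s2"
          and L: "code_expr (FUnion bs1) < L" "code_expr (FUnion bs2) < L"
          and eq: "code_expr (FUnion bs1) + code_expr (FUnion bs2) =
            code_expr e + code_expr e'" for bs1 s1 bs2 s2
        unfolding incl_vl_def
      proof (unfold disj_imp not_not, clarify)
        fix e1 xs1 \<phi>1 t1
        assume 1: "(e1, xs1, \<phi>1) \<in> set bs1" "t1 < B" "agree_off N L (list_encode xs1) s1 t1"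
          "sat (vl t1) \<phi>1"
        with justified_fm_sound[OF J(1) branch_less_L(3)[OF L(1) 1(1)], of t1]
        have "\<not> fact_fm W 0 (code_fm \<phi>1) t1" by blast
        with bspec[OF fact[unfolded fact_incl_code[OF L]] 1(1)] 1
        obtain e2 xs2 \<phi>2 t2 where 2: "(e2, xs2, \<phi>2) \<in> set bs2" "t2 < B"
          "agree_off N L (list_encode xs2) s2 t2"
          "fact_fm W 1 (code_fm \<phi>2) t2" "fact_eq W (code_expr e1) t1 (code_expr e2) t2" by blast
        have "sat (vl t2) \<phi>2"
          using justified_fm_sound[OF J(1) branch_less_L(3)[OF L(2) 2(1)], of t2] 2 by blast
        moreover have "eval e1 (vl t1) = eval e2 (vl t2)"
        proof (rule less.hyps)
          show "code_expr e1 + code_expr e2 < code_expr e + code_expr e'"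
            unfolding eq[symmetric]
            using code_branch_less[OF 1(1)] code_branch_less[OF 2(1)]
              code_branch_components(1)[of e1 xs1 \<phi>1]
              code_branch_components(1)[of e2 xs2 \<phi>2] by linarith
        qed (use branch_less_L(2)[OF L(1) 1(1)] branch_less_L(2)[OF L(2) 2(1)] 1 2 in auto)
        ultimately show "\<exists>(e', xs', \<phi>') \<in> set bs2. \<exists>t'<B. agree_off N L (list_encode xs') s2 t' \<and>
          sat (vl t') \<phi>' \<and> eval e1 (vl t1) = eval e' (vl t')"
          using 2(2,3) by (intro bexI[OF _ 2(1)]) auto
      qed
      have facts: "fact_incl N L W (code_expr e) s (code_expr e') s'"
        "fact_incl N L W (code_expr e') s' (code_expr e) s"
        using just(2) e by (simp_all add: pfst_code_expr)
      note less_L' = less_L[unfolded e e']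
      have "incl_vl bs s bs' s'" "incl_vl bs' s' bs s"
        using facts less_L' by (intro incl; simp add: e e' add.commute)+
      then have "elems (eval (FUnion bs) (vl s)) = elems (eval (FUnion bs') (vl s'))"
        using incl_vl_iff less_L' less.prems by blast
      then show ?thesis unfolding e e' by (rule eval_FUnion_eqI)
    qed
  qed
qed

section \<open>Completeness: the certificate consisting of all true facts\<close>

definition true_facts :: "nat set" where
  "true_facts =
    {prod_encode (of_bool (sat (vl s) \<phi>), prod_encode (code_fm \<phi>, s)) | \<phi> s. code_fm \<phi> < L \<and> s < B} \<union>
    {prod_encode (2, prod_encode (prod_encode (code_expr e, s), prod_encode (code_expr e', s'))) |
      e s e' s'.
      code_expr e < L \<and> code_expr e' < L \<and> s < B \<and> s' < B \<and> eval e (vl s) = eval e' (vl s')}"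

lemma true_facts_less: "true_facts \<subseteq> {..<fact_bound N L}"
  unfolding true_facts_def fact_bound_def Let_def
  by (auto simp: less_Suc_eq_le simp del: prod_encode_eq intro!: prod_encode_mono split: split_of_bool)
    (rule le_prod_encode(1), simp)+

lemma set_encode_less: "A \<subseteq> {..<m} \<Longrightarrow> set_encode A < 2 ^ m"
proof -
  assume "A \<subseteq> {..<m}"
  then have "set_encode A \<le> (\<Sum>i<m. 2 ^ i)" unfolding set_encode_def by (intro sum_mono2) auto
  also have "\<dots> < 2 ^ m" by (induction m) auto
  finally show ?thesis .
qed

lemma true_facts_decode: "set_decode (set_encode true_facts) = true_facts"
  using true_facts_less finite_subset by (intro set_encode_inverse) blast

text \<open>Tag \<open>2\<close> is excluded because it belongs to the equality facts.\<close>

lemma fact_fm_true: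
  "b \<noteq> 2 \<Longrightarrow> fact_fm (set_encode true_facts) b f s \<longleftrightarrow>
    (\<exists>\<phi>. f = code_fm \<phi> \<and> f < L \<and> s < B \<and> b = of_bool (sat (vl s) \<phi>))"
  unfolding fact_fm_def true_facts_decode by (auto simp: true_facts_def split: split_of_bool)

lemma fact_fm_true_code:
  assumes "code_fm \<phi> < L" "s < B"
  shows "fact_fm (set_encode true_facts) 1 (code_fm \<phi>) s \<longleftrightarrow> sat (vl s) \<phi>"
    "fact_fm (set_encode true_facts) 0 (code_fm \<phi>) s \<longleftrightarrow> \<not> sat (vl s) \<phi>"
  using assms by (auto simp: fact_fm_true dest: code_fm_inject)

lemma fact_eq_true:
  "fact_eq (set_encode true_facts) k s k' s' \<longleftrightarrow> (\<exists>e e'. k = code_expr e \<and> k' = code_expr e' \<and>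
     k < L \<and> k' < L \<and> s < B \<and> s' < B \<and> eval e (vl s) = eval e' (vl s'))"
  unfolding fact_eq_def true_facts_decode by (auto simp: true_facts_def)

lemma fact_eq_true_code:
  assumes "code_expr e < L" "code_expr e' < L" "s < B" "s' < B"
  shows "fact_eq (set_encode true_facts) (code_expr e) s (code_expr e') s' \<longleftrightarrow>
    eval e (vl s) = eval e' (vl s')"
  unfolding fact_eq_true using assms by (auto dest: code_expr_inject)

lemma justified_fm_true: "justified_fm N L (set_encode true_facts)"
  unfolding justified_fm_def
proof (intro allI impI, goal_cases)
  case (1 f s)
  note true = fact_fm_true_code fact_fm_true_code[unfolded One_nat_def]
  show ?case
  proof (cases "\<exists>\<phi>. f = code_fm \<phi>")
    case True
    then obtain \<phi> where f: "f = code_fm \<phi>" by blast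
    note \<phi> = 1[unfolded f]
    show ?thesis
    proof (cases \<phi>)
      case (FEq x y)
      then show ?thesis unfolding f fact_fm_true_code[OF \<phi>] by simp
    next
      case (FNeg \<psi>)
      then show ?thesis unfolding f fact_fm_true_code[OF \<phi>]
        using fm_code_less(1)[of \<psi>] \<phi> by (simp add: true)
    next
      case (FConj \<psi> \<chi>)
      then show ?thesis unfolding f fact_fm_true_code[OF \<phi>]
        using fm_code_less(2)[of \<psi> \<chi>] \<phi> by (simp add: true)
    next
      case (FEx x \<psi>)
      then have "sat (vl s) \<phi> \<longleftrightarrow> (\<exists>t<B. agree_off N L (Suc (prod_encode (x, 0))) s t \<and> sat (vl t) \<psi>)"
        using sat_FEx_vl[of x \<psi> s] \<phi> by (simp del: sat.simps)
      then show ?thesis unfolding f fact_fm_true_code[OF \<phi>]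
        using fm_code_less(3)[of x \<psi>] \<phi> FEx by (auto simp: true simp del: sat.simps)
    qed
  \<comment> \<open>If \<open>f\<close> codes no formula, then no true fact with tag
    \<open>0\<close> or \<open>1\<close> mentions it.\<close>
  qed (auto simp: fact_fm_true)
qed

lemma justified_eq_true: "justified_eq N L (set_encode true_facts)"
  unfolding justified_eq_def
proof (intro allI impI, goal_cases)
  case (1 k k' s s')
  then obtain e e' where k: "k = code_expr e" "k' = code_expr e'" and
    eq: "eval e (vl s) = eval e' (vl s')"
    unfolding fact_eq_true by blast
  note less = 1(1-4)[unfolded k]
  show ?case
  proof (cases e)
    case (Var x)
    with eq show ?thesis unfolding k by (cases e') (simp_all add: eval.simps pfst_code_expr)
  next
    case e: (FUnion bs)
    with eq obtain bs' where e': "e' = FUnion bs'" by (cases e') (simp_all add: eval.simps)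
    have incl: "fact_incl N L (set_encode true_facts) (code_expr (FUnion bs1)) s1
        (code_expr (FUnion bs2)) s2"
      if eq: "eval (FUnion bs1) (vl s1) = eval (FUnion bs2) (vl s2)" and s: "s1 < B" "s2 < B"
        and L: "code_expr (FUnion bs1) < L" "code_expr (FUnion bs2) < L" for bs1 s1 bs2 s2
      unfolding fact_incl_code[OF L]
    proof (unfold disj_imp, clarify)
      fix e1 xs1 \<phi>1 t1
      assume 1: "(e1, xs1, \<phi>1) \<in> set bs1" "t1 < B" "agree_off N L (list_encode xs1) s1 t1"
        "\<not> fact_fm (set_encode true_facts) 0 (code_fm \<phi>1) t1"
      have "incl_vl bs1 s1 bs2 s2" using incl_vl_iff[OF L s] eq by simp
      from bspec[OF this[unfolded incl_vl_def] 1(1)] 1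
      obtain e2 xs2 \<phi>2 t2 where 2: "(e2, xs2, \<phi>2) \<in> set bs2" "t2 < B"
        "agree_off N L (list_encode xs2) s2 t2"
        "sat (vl t2) \<phi>2" "eval e1 (vl t1) = eval e2 (vl t2)"
        using fact_fm_true_code(2)[OF branch_less_L(3)[OF L(1) 1(1)] 1(2)] by blast
      then show "\<exists>(e', xs', \<phi>') \<in> set bs2. \<exists>t'<B. agree_off N L (list_encode xs') s2 t' \<and>
          fact_fm (set_encode true_facts) 1 (code_fm \<phi>') t' \<and>
            fact_eq (set_encode true_facts) (code_expr e1) t1 (code_expr e') t'"
        using fact_fm_true_code(1)[OF branch_less_L(3)[OF L(2) 2(1)] 2(2)]
          fact_eq_true_code[OF branch_less_L(2)[OF L(1) 1(1)] branch_less_L(2)[OF L(2) 2(1)] 1(2) 2(2)]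
        by (intro bexI[OF _ 2(1)]) auto
    qed
    then show ?thesis
      using eq less unfolding k e e' by (simp add: pfst_code_expr)
  qed
qed

section \<open>Certificates for covers\<close>

definition cover_vl :: "(expr \<times> var list \<times> fm) list \<Rightarrow> nat \<Rightarrow>
  (expr \<times> var list \<times> fm) list \<Rightarrow> nat \<Rightarrow> bool" where
  "cover_vl bs s bs' s' \<longleftrightarrow> (\<forall>(e, xs, \<phi>) \<in> set bs. \<forall>t<B. agree_off N L (list_encode xs) s t \<longrightarrow>
    \<not> sat (vl t) \<phi> \<or>
     (\<exists>(e', xs', \<phi>') \<in> set bs'. \<exists>t'<B. agree_off N L (list_encode xs') s' t' \<and> sat (vl t') \<phi>' \<and>
        (\<forall>x<L. digit N t' x < 3 * L) \<and> eval e (vl t) \<in> elems (eval e' (vl t'))))"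

text \<open>The expression \<open>e'\<close> is not yet split into branches: it could be a variable
  if its guard is never satisfied.\<close>

lemma fact_cover_code:
  assumes "code_expr (FUnion bs) < L" "code_expr (FUnion bs') < L"
  shows "fact_cover N L W (code_expr (FUnion bs)) s (code_expr (FUnion bs')) s' \<longleftrightarrow>
    (\<forall>(e, xs, \<phi>) \<in> set bs. \<forall>t<B. agree_off N L (list_encode xs) s t \<longrightarrow> fact_fm W 0 (code_fm \<phi>) t \<or>
     (\<exists>(e', xs', \<phi>') \<in> set bs'. \<exists>t'<B. agree_off N L (list_encode xs') s' t' \<and>
       fact_fm W 1 (code_fm \<phi>') t' \<and>
        (\<forall>x<L. digit N t' x < 3 * L) \<and>
        (\<exists>d<L. d \<in> set (list_decode (psnd (code_expr e'))) \<and>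
              (\<exists>u<N ^ L. agree_off N L (pfst (psnd d)) t' u \<and> fact_fm W 1 (psnd (psnd d)) u \<and>
                fact_eq W (code_expr e) t (pfst d) u))))"
  unfolding fact_cover_def ball_branches[OF assms(1)] bex_branches[OF assms(2)] code_branch_projections
  by (rule refl)

lemma fact_cover_member:
  assumes "code_expr (FUnion cs) < L"
  shows "(\<exists>d<L. d \<in> set (list_decode (psnd (code_expr (FUnion cs)))) \<and>
      (\<exists>u<N ^ L. agree_off N L (pfst (psnd d)) t' u \<and> fact_fm W 1 (psnd (psnd d)) u \<and>
        fact_eq W k t (pfst d) u)) \<longleftrightarrow>
    (\<exists>(e', xs', \<phi>') \<in> set cs. \<exists>u<B. agree_off N L (list_encode xs') t' u \<and> fact_fm W 1 (code_fm \<phi>') u \<and>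
      fact_eq W k t (code_expr e') u)"
  unfolding bex_branches[OF assms] code_branch_projections by (rule refl)

lemma fact_cover_sound:
  assumes J: "justified_fm N L W" "justified_eq N L W"
    and cover: "fact_cover N L W (code_expr (FUnion bs)) s (code_expr (FUnion bs')) s'"
    and bs: "code_expr (FUnion bs) < L" "code_expr (FUnion bs') < L" and s: "s < B" "s' < B"
    and fam: "\<forall>Y \<in> elems (eval (FUnion bs') (vl s')). is_set Y"
  shows "cover_vl bs s bs' s'"
  unfolding cover_vl_def
proof (unfold disj_imp not_not, clarify)
  fix e xs \<phi> t
  assume 1: "(e, xs, \<phi>) \<in> set bs" "t < B" "agree_off N L (list_encode xs) s t" "sat (vl t) \<phi>"
  note less1 = branch_less_L[OF bs(1) 1(1)]
  have "\<not> fact_fm W 0 (code_fm \<phi>) t" using justified_fm_sound[OF J(1) less1(3) 1(2)] 1(4) by blast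
  with bspec[OF cover[unfolded fact_cover_code[OF bs]] 1(1)] 1
  obtain e' xs' \<phi>' t' where 2: "(e', xs', \<phi>') \<in> set bs'" "t' < B"
    "agree_off N L (list_encode xs') s' t'"
    "fact_fm W 1 (code_fm \<phi>') t'" "\<forall>x<L. digit N t' x < 3 * L"
    "\<exists>d<L. d \<in> set (list_decode (psnd (code_expr e'))) \<and>
      (\<exists>u<N ^ L. agree_off N L (pfst (psnd d)) t' u \<and> fact_fm W 1 (psnd (psnd d)) u \<and>
        fact_eq W (code_expr e) t (pfst d) u)"
    by blast
  note less2 = branch_less_L[OF bs(2) 2(1)]
  have sat: "sat (vl t') \<phi>'" using justified_fm_sound[OF J(1) less2(3) 2(2)] 2(4) by blast
  then have "eval e' (vl t') \<in> elems (eval (FUnion bs') (vl s'))"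
    unfolding elems_FUnion using 2(1,3) agree_off_iff[OF s(2) 2(2)] by blast
  \<comment> \<open>Since the guard holds at \<open>t'\<close>, the value of \<open>e'\<close>
    belongs to the family and is a set, which rules out a variable.\<close>
  with fam obtain cs where e': "e' = FUnion cs" by (cases e') (auto simp: eval.simps)
  from 2(6)[unfolded e' fact_cover_member[OF less2(2)[unfolded e']]]
  obtain d ys \<psi> u where 3: "(d, ys, \<psi>) \<in> set cs" "u < B" "agree_off N L (list_encode ys) t' u"
    "fact_fm W 1 (code_fm \<psi>) u" "fact_eq W (code_expr e) t (code_expr d) u"
    by blast
  note less3 = branch_less_L[OF less2(2)[unfolded e'] 3(1)]
  have "sat (vl u) \<psi>" using justified_fm_sound[OF J(1) less3(3) 3(2)] 3(4) by blast
  moreover have "eval e (vl t) = eval d (vl u)"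
    using justified_eq_sound[OF J less1(2) less3(2) 1(2) 3(2,5)] .
  ultimately have "eval e (vl t) \<in> elems (eval e' (vl t'))"
    unfolding e' mem_FUnion_vl[OF less1(2) less2(2)[unfolded e'] 1(2) 2(2)]
    using 3(2,3) by (intro bexI[OF _ 3(1)]) auto
  then show "\<exists>(e', xs', \<phi>') \<in> set bs'. \<exists>t'<B. agree_off N L (list_encode xs') s' t' \<and> sat (vl t') \<phi>' \<and>
        (\<forall>x<L. digit N t' x < 3 * L) \<and> eval e (vl t) \<in> elems (eval e' (vl t'))"
    using 2 sat by (intro bexI[OF _ 2(1)]) auto
qed

lemma fact_cover_true:
  assumes cover: "cover_vl bs s bs' s'"
    and bs: "code_expr (FUnion bs) < L" "code_expr (FUnion bs') < L" and s: "s < B" "s' < B"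
  shows "fact_cover N L (set_encode true_facts) (code_expr (FUnion bs)) s (code_expr (FUnion bs')) s'"
  unfolding fact_cover_code[OF bs]
proof (unfold disj_imp, clarify)
  let ?W = "set_encode true_facts"
  fix e xs \<phi> t
  assume 1: "(e, xs, \<phi>) \<in> set bs" "t < B" "agree_off N L (list_encode xs) s t"
    "\<not> fact_fm ?W 0 (code_fm \<phi>) t"
  note less1 = branch_less_L[OF bs(1) 1(1)]
  have "sat (vl t) \<phi>" using fact_fm_true_code(2)[OF less1(3) 1(2)] 1(4) by blast
  with bspec[OF cover[unfolded cover_vl_def] 1(1)] 1
  obtain e' xs' \<phi>' t' where 2: "(e', xs', \<phi>') \<in> set bs'" "t' < B"
    "agree_off N L (list_encode xs') s' t'"
    "sat (vl t') \<phi>'" "\<forall>x<L. digit N t' x < 3 * L" "eval e (vl t) \<in> elems (eval e' (vl t'))"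
    by blast
  note less2 = branch_less_L[OF bs(2) 2(1)]
  \<comment> \<open>An atom has no elements, so \<open>e'\<close> is a union.\<close>
  from 2(6) obtain cs where e': "e' = FUnion cs" by (cases e') (auto simp: eval.simps)
  from 2(6)[unfolded e' mem_FUnion_vl[OF less1(2) less2(2)[unfolded e'] 1(2) 2(2)]]
  obtain d ys \<psi> u where 3: "(d, ys, \<psi>) \<in> set cs" "u < B" "agree_off N L (list_encode ys) t' u"
    "sat (vl u) \<psi>" "eval e (vl t) = eval d (vl u)"
    by blast
  note less3 = branch_less_L[OF less2(2)[unfolded e'] 3(1)]
  have "\<exists>d<L. d \<in> set (list_decode (psnd (code_expr e'))) \<and>
      (\<exists>u<N ^ L. agree_off N L (pfst (psnd d)) t' u \<and> fact_fm ?W 1 (psnd (psnd d)) u \<and>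
        fact_eq ?W (code_expr e) t (pfst d) u)"
    unfolding e' fact_cover_member[OF less2(2)[unfolded e']]
    using 3 fact_fm_true_code(1)[OF less3(3) 3(2)] fact_eq_true_code[OF less1(2) less3(2) 1(2) 3(2)]
    by (intro bexI[OF _ 3(1)]) auto
  then show "\<exists>(e', xs', \<phi>') \<in> set bs'. \<exists>t'<B. agree_off N L (list_encode xs') s' t' \<and>
    fact_fm ?W 1 (code_fm \<phi>') t' \<and>
        (\<forall>x<L. digit N t' x < 3 * L) \<and>
        (\<exists>d<L. d \<in> set (list_decode (psnd (code_expr e'))) \<and>
              (\<exists>u<N ^ L. agree_off N L (pfst (psnd d)) t' u \<and> fact_fm ?W 1 (psnd (psnd d)) u \<and>
                fact_eq ?W (code_expr e) t (pfst d) u))"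
    using 2 fact_fm_true_code(1)[OF less2(3) 2(2)] by (intro bexI[OF _ 2(1)]) auto
qed

section \<open>Finite covers\<close>

lemma cover_vl_iff:
  assumes fam: "set_family_on (eval (FUnion bs) (vl s)) (eval (FUnion bs') (vl s'))"
    and bs: "code_expr (FUnion bs) < L" "code_expr (FUnion bs') < L" and s: "s < B" "s' < B"
    and params: "\<forall>x<L. digit N s x < L" "\<forall>x<L. digit N s' x < L"
  shows "has_finite_cover (eval (FUnion bs) (vl s)) (eval (FUnion bs') (vl s')) \<longleftrightarrow> cover_vl bs s bs' s'"
    (is "has_finite_cover ?X ?S \<longleftrightarrow> _")
proof
  have par: "vl s x \<in> atoms L" "vl s' x \<in> atoms L" for x
    using params digit_beyond[OF s(1), of x] digit_beyond[OF s(2), of x] L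
    by (cases "x < L"; simp add: vl_atoms)+
  \<comment> \<open>Room for the first \<open>L\<close> atoms, which contain the parameters, for the
    \<open>L\<close> atoms of an element, and for the \<open>L\<close> atoms of a member of the
    cover.\<close>
  define T where "T = atoms (3 * L)"
  have T: "finite T" "card T = 3 * L" "atoms L \<subseteq> T" by (auto simp: T_def mem_atoms)
  have var_bij: "\<pi> \<circ> \<tau> \<in> variants (vl r) xs"
    if "bij \<pi>" "\<And>a. a \<in> atoms L \<Longrightarrow> \<pi> a = a" "\<tau> \<in> variants (vl r) xs" "r \<in> {s, s'}" for \<pi> \<tau> r xs
    using that par by (auto simp: variants_def simp del: vl_eq)
  {
    assume "has_finite_cover ?X ?S"
    then obtain C where C: "C \<subseteq> elems ?S" "finite C" "(\<Union>Y\<in>C. elems Y) = elems ?X"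
      unfolding has_finite_cover_def by blast
    \<comment> \<open>\<open>M\<close> collects the atoms of one chosen valuation for each member of
      the finite cover.\<close>
    have "\<exists>M. finite M \<and> (\<forall>Y\<in>C. \<exists>(e, xs, \<phi>) \<in> set bs'. \<exists>\<tau> \<in> variants (vl s') xs.
        sat \<tau> \<phi> \<and> Y = eval e \<tau> \<and> \<tau> ` {..<L} \<subseteq> M)"
      using C(2,1)
    proof (induction C rule: finite_induct)
      case (insert Y C)
      then obtain M where M: "finite M" "\<forall>Y\<in>C. \<exists>(e, xs, \<phi>) \<in> set bs'. \<exists>\<tau> \<in> variants (vl s') xs.
        sat \<tau> \<phi> \<and> Y = eval e \<tau> \<and> \<tau> ` {..<L} \<subseteq> M" by auto
      from insert.prems obtain e xs \<phi> \<tau> where Y: "(e, xs, \<phi>) \<in> set bs'" "\<tau> \<in> variants (vl s') xs"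
        "sat \<tau> \<phi>" "Y = eval e \<tau>"
        unfolding elems_FUnion by blast
      show ?case
        using M Y by (intro exI[of _ "M \<union> \<tau> ` {..<L}"]) fast
    qed auto
    then obtain M where M: "finite M" "\<And>Y. Y \<in> C \<Longrightarrow> \<exists>(e, xs, \<phi>) \<in> set bs'. \<exists>\<tau> \<in> variants (vl s') xs.
        sat \<tau> \<phi> \<and> Y = eval e \<tau> \<and> \<tau> ` {..<L} \<subseteq> M" by blast
    show "cover_vl bs s bs' s'"
      unfolding cover_vl_def
    proof (unfold disj_imp not_not, clarify)
      fix e xs \<phi> t
      assume b: "(e, xs, \<phi>) \<in> set bs" and t: "t < B" "agree_off N L (list_encode xs) s t" "sat (vl t) \<phi>"
      note less1 = branch_less_L[OF bs(1) b]
      define D where "D = vl t ` {..<L}"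
      have D: "finite D" "card D \<le> L" using card_range_le by (auto simp: D_def)
      text \<open>Move the atoms of the element outside \<open>T\<close> away from the finitely many atoms of the cover,
        so that the cover can only use atoms of the element that lie in \<open>T\<close>.\<close>
      have "infinite (UNIV - (T \<union> M \<union> D))"
        using infinite_atoms T(1) M(1) D(1) by simp
      \<comment> \<open>The size \<open>4 * L\<close> accommodates the at most \<open>L\<close>
        atoms to be moved and the \<open>3 * L\<close> atoms of \<open>T\<close> to be
        fixed.\<close>
      then obtain U where U: "finite U" "card U = 4 * L" "U \<subseteq> UNIV - (T \<union> M \<union> D)"
        using infinite_arbitrarily_large by blast
      obtain \<pi> where \<pi>: "bij \<pi>" "\<And>a. a \<in> T \<Longrightarrow> \<pi> a = a" "\<pi> ` (D - T) \<subseteq> U"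
        using bij_moving_into[of U "D - T" T] U T D card_mono[of D "D - T"] by auto
      have vt: "vl t \<in> variants (vl s) xs" using t agree_off_iff[OF s(1)] by blast
      have "\<pi> \<circ> vl t \<in> variants (vl s) xs" using \<pi> T vt by (intro var_bij) auto
      moreover have "sat (\<pi> \<circ> vl t) \<phi>" using sat_bij[OF \<pi>(1)] t(3) by blast
      ultimately have "eval e (\<pi> \<circ> vl t) \<in> elems ?X" unfolding elems_FUnion using b by blast
      then obtain Y where Y: "Y \<in> C" "eval e (\<pi> \<circ> vl t) \<in> elems Y" unfolding C(3)[symmetric] by blast
      from M(2)[OF Y(1)] obtain e' xs' \<phi>' \<tau> where b': "(e', xs', \<phi>') \<in> set bs'" and
        \<tau>: "\<tau> \<in> variants (vl s') xs'" "sat \<tau> \<phi>'" "Y = eval e' \<tau>" "\<tau> ` {..<L} \<subseteq> M" by blast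
      note less2 = branch_less_L[OF bs(2) b']
      \<comment> \<open>Undoing \<open>\<pi>\<close> turns the member that contains the moved
        element into a member that contains the original one.\<close>
      define \<tau>1 where "\<tau>1 = inv \<pi> \<circ> \<tau>"
      have inv: "bij (inv \<pi>)" "inv \<pi> (\<pi> a) = a" "\<pi> (inv \<pi> a) = a" for a
        using \<pi>(1) by (auto simp: bij_imp_bij_inv bij_is_inj bij_is_surj surj_f_inv_f)
      have \<tau>_eq: "\<tau> = \<pi> \<circ> \<tau>1" by (auto simp: \<tau>1_def inv)
      have inv_T: "inv \<pi> a = a" if "a \<in> T" for a using \<pi>(2)[OF that] inv(2)[of a] by simp
      define E where "E = \<tau>1 ` {..<L}"
      \<comment> \<open>An atom of both \<open>E\<close> and \<open>D\<close> outside
        \<open>T\<close> would be sent by \<open>\<pi>\<close> into \<open>U\<close> and into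
        \<open>M\<close>, which are disjoint.\<close>
      have "E \<inter> (atoms L \<union> D) \<subseteq> T"
      proof
        fix a assume a: "a \<in> E \<inter> (atoms L \<union> D)"
        show "a \<in> T"
        proof (rule ccontr)
          assume "a \<notin> T"
          with a T(3) have "\<pi> a \<in> U" using \<pi>(3) by auto
          moreover have "\<pi> a \<in> M" using a \<tau>(4) by (auto simp: E_def \<tau>1_def inv)
          ultimately show False using U(3) by blast
        qed
      qed
      moreover have "card E + card (atoms L \<union> D) \<le> card T"
        using card_range_le[of \<tau>1] card_Un_le[of "atoms L" D] D(2) T(2) by (simp add: E_def)
      \<comment> \<open>The member is moved into \<open>T\<close> while the parameters and the
        element stay in place.\<close>
      ultimately obtain \<kappa> where \<kappa>: "bij \<kappa>" "\<And>a. a \<in> atoms L \<union> D \<Longrightarrow> \<kappa> a = a" "\<kappa> ` E \<subseteq> T"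
        using bij_moving_into[of T E "atoms L \<union> D"] T(1) D(1) by (auto simp: E_def)
      have "\<forall>x<L. \<kappa> (\<tau>1 x) \<in> atoms (3 * L)" using \<kappa>(3) by (auto simp: E_def T_def)
      moreover have "3 * L \<le> N" by (simp add: N)
      ultimately obtain t' where t': "t' < B" "\<forall>x<L. vl t' x = \<kappa> (\<tau>1 x)" "\<forall>x<L. digit N t' x < 3 * L"
        using ex_vl[of "\<lambda>x. \<kappa> (\<tau>1 x)" "3 * L"] by (auto simp flip: vl_atoms)
      have "\<kappa> \<circ> \<tau>1 \<in> variants (vl s') xs'"
        unfolding \<tau>1_def using \<tau>(1) \<kappa> inv(1) inv_T T(3) by (intro var_bij) auto
      then have "agree_off N L (list_encode xs') s' t'"
        using t'(2) by (auto simp: agree_off_def variants_def simp del: vl_eq simp flip: vl_eq)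
      moreover have "sat (vl t') \<phi>'"
        using sat_vl_cong[OF less2(3), of "vl t'"
          "\<kappa> \<circ> \<tau>1"] t'(2) sat_bij[OF \<kappa>(1)] sat_bij[OF inv(1)] \<tau>(2)
        by (simp add: \<tau>1_def)
      moreover have "eval e (vl t) \<in> elems (eval e' (vl t'))"
      proof -
        have "map_hset \<pi> (eval e (vl t)) \<in> map_hset \<pi> ` elems (eval e' \<tau>1)"
          using Y(2) unfolding \<tau>(3) \<tau>_eq eval_bij[OF countable_atoms \<pi>(1)] elems_map_hset .
        then have "eval e (vl t) \<in> elems (eval e' \<tau>1)"
          by (simp add: inj_image_mem_iff hset.inj_map bij_is_inj[OF \<pi>(1)])
        then have "map_hset \<kappa> (eval e (vl t)) \<in> elems (eval e' (\<kappa> \<circ> \<tau>1))"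
          unfolding eval_bij[OF countable_atoms \<kappa>(1)] elems_map_hset by (rule imageI)
        moreover have "map_hset \<kappa> (eval e (vl t)) = eval e (vl t)"
          using \<kappa>(2) by (intro fixed_value[OF less1(2) \<kappa>(1)]) (auto simp: D_def)
        moreover have "eval e' (\<kappa> \<circ> \<tau>1) = eval e' (vl t')"
          using t'(2) by (intro eval_vl_cong[OF less2(2)]) simp
        ultimately show ?thesis by simp
      qed
      ultimately show "\<exists>(e', xs', \<phi>') \<in> set bs'. \<exists>t'<B. agree_off N L (list_encode xs') s' t' \<and>
        sat (vl t') \<phi>' \<and>
        (\<forall>x<L. digit N t' x < 3 * L) \<and> eval e (vl t) \<in> elems (eval e' (vl t'))"
        using t' by (intro bexI[OF _ b']) auto
    qed
  }
  {
    assume cover: "cover_vl bs s bs' s'"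
    \<comment> \<open>The finite subfamily consists of the members with valuations in
      \<open>T\<close>.\<close>
    define C where "C = {eval e' (vl t') | e' xs' \<phi>' t'. (e', xs', \<phi>') \<in> set bs' \<and> t' < B \<and>
      agree_off N L (list_encode xs') s' t' \<and> sat (vl t') \<phi>' \<and> (\<forall>x<L. digit N t' x < 3 * L)}"
    have "C \<subseteq> (\<lambda>(b, t'). eval (fst b) (vl t')) ` (set bs' \<times> {..<B})"
      unfolding C_def by force
    then have "finite C" by (rule finite_subset) simp
    moreover have CS: "C \<subseteq> elems ?S"
      unfolding C_def elems_FUnion using agree_off_iff[OF s(2)] by blast
    moreover have "elems ?X \<subseteq> (\<Union>Y\<in>C. elems Y)"
    proof
      fix v assume "v \<in> elems ?X"
      then obtain e xs \<phi> \<tau> where b: "(e, xs, \<phi>) \<in> set bs" and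
        \<tau>: "\<tau> \<in> variants (vl s) xs" "sat \<tau> \<phi>" "v = eval e \<tau>"
        unfolding elems_FUnion by blast
      note less1 = branch_less_L[OF bs(1) b]
      have "T \<subseteq> atoms N" using N by (auto simp: T_def mem_atoms)
      moreover have "vl s ` {..<L} \<subseteq> T" using par T(3) by auto
      \<comment> \<open>Fixing \<open>T\<close> pointwise fixes every member of \<open>C\<close>, so
        a member that contains the moved element contains \<open>v\<close> as well.\<close>
      ultimately obtain \<pi> t where p: "bij \<pi>" "\<And>a. a \<in> T \<Longrightarrow> \<pi> a = a" "t < B" "vl t \<in> variants (vl s) xs"
        "\<And>\<phi>. code_fm \<phi> < L \<Longrightarrow> sat (vl t) \<phi> \<longleftrightarrow> sat \<tau> \<phi>"
        "\<And>e. code_expr e < L \<Longrightarrow> eval e (vl t) = map_hset \<pi> (eval e \<tau>)"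
        using move_into_code[OF _ _ \<tau>(1) s(1), of T] T(2) by (metis order_refl)
      have "sat (vl t) \<phi>" "agree_off N L (list_encode xs) s t"
        using p \<tau>(2) less1(3) agree_off_iff[OF s(1)] by auto
      with bspec[OF cover[unfolded cover_vl_def] b] p(3)
      obtain e' xs' \<phi>' t' where 2: "(e', xs', \<phi>') \<in> set bs'" "t' < B"
        "agree_off N L (list_encode xs') s' t'"
        "sat (vl t') \<phi>'" "\<forall>x<L. digit N t' x < 3 * L" "eval e (vl t) \<in> elems (eval e' (vl t'))"
        by blast
      note less2 = branch_less_L[OF bs(2) 2(1)]
      have "map_hset \<pi> (eval e' (vl t')) = eval e' (vl t')"
        using 2(5) p(2) by (intro fixed_value[OF less2(2) p(1)]) (auto simp: T_def vl_atoms)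
      then have "map_hset \<pi> v \<in> map_hset \<pi> ` elems (eval e' (vl t'))"
        using 2(6) p(6)[OF less1(2)] \<tau>(3) by (simp flip: elems_map_hset)
      then have "v \<in> elems (eval e' (vl t'))"
        by (simp add: inj_image_mem_iff hset.inj_map bij_is_inj[OF p(1)])
      moreover have "eval e' (vl t') \<in> C" unfolding C_def using 2 by blast
      ultimately show "v \<in> (\<Union>Y\<in>C. elems Y)" by blast
    qed
    moreover have "(\<Union>Y\<in>C. elems Y) \<subseteq> elems ?X"
      using fam CS unfolding set_family_on_def by blast
    ultimately show "has_finite_cover ?X ?S" unfolding has_finite_cover_def by blast
  }
qed

section \<open>Parameters of an instance\<close>

lemma binding_code_less:
  assumes "code_pres c (e, \<rho>) < L" "(x, a) \<in> set \<rho>"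
  shows "prod_encode (x, c a) < L"
proof -
  have "prod_encode (x, c a) < list_encode (map (\<lambda>(x, a). prod_encode (x, c a)) \<rho>)"
    using assms(2) by (intro list_encode_member_less) force
  also have "\<dots> \<le> code_pres c (e, \<rho>)" by (simp add: code_pres_def le_prod_encode_2)
  finally show ?thesis using assms(1) by simp
qed

lemma extends_iff:
  assumes "code_pres c (e, \<rho>) < L"
  shows "extends N L (psnd (code_pres c (e, \<rho>))) s \<longleftrightarrow>
    (\<forall>x<L. digit N s x < L) \<and> (\<forall>(x, a) \<in> set \<rho>. vl s x = a)"
proof -
  have mem: "set (list_decode (psnd (code_pres c (e, \<rho>)))) = (\<lambda>(x, a). prod_encode (x, c a)) ` set \<rho>"
    by (simp add: code_pres_def)
  have "digit N s x = c a \<longleftrightarrow> vl s x = a" for x a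
    by (metis inv_c vl_def)
  then show ?thesis
    unfolding extends_def mem using binding_code_less[OF assms] by (auto simp: ball_conj_distrib) force
qed

lemma extends_eval:
  assumes "is_pres (e, \<rho>)" "\<forall>(x, a) \<in> set \<rho>. vl s x = a"
  shows "eval e (vl s) = val (e, \<rho>)"
proof -
  have "vl s x = the (map_of \<rho> x)" if "x \<in> fv e" for x
  proof -
    have "x \<in> fst ` set \<rho>" using assms(1) that by (auto simp: is_pres_def)
    then obtain a where "map_of \<rho> x = Some a" by (metis map_of_eq_None_iff not_Some_eq option.exhaust)
    then show ?thesis using assms(2) map_of_SomeD[of \<rho> x a] by auto
  qed
  then show ?thesis by (auto simp: val_def intro: eval_cong)
qed

lemma ex_extends:
  assumes "is_pres (e, \<rho>)" "code_pres c (e, \<rho>) < L"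
  shows "\<exists>s<B. extends N L (psnd (code_pres c (e, \<rho>))) s"
proof -
  have less: "x < L \<and> c a < L" if "(x, a) \<in> set \<rho>" for x a
    using binding_code_less[OF assms(2) that] le_prod_encode_1[of x "c a"]
      le_prod_encode_2[of "c a" x] by simp
  \<comment> \<open>The default \<open>0\<close> outside the graph is an admissible digit because
    \<open>L\<close> is positive.\<close>
  define g where "g x = (case map_of \<rho> x of None \<Rightarrow> 0 | Some a \<Rightarrow> c a)" for x
  have g: "g x < L" for x
    using L less by (auto simp: g_def dest: map_of_SomeD split: option.split)
  then have "g x < N" for x using N less_le_trans[of "g x" L N] by simp
  then obtain s where s: "s < B" "\<forall>x<L. digit N s x = g x" using ex_digits[of L g N] by blast
  have "vl s x = a" if "(x, a) \<in> set \<rho>" for x a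
    using assms(1) that less[OF that] s(2) by (simp add: is_pres_def vl_def g_def)
  then show ?thesis using s g extends_iff[OF assms(2)] by auto
qed

lemma certified_cover_iff:
  assumes pq: "(p, q) \<in> set_covering_instances" and n: "n = code_instance c (p, q)" "n < L"
  shows "certified_cover N L n \<longleftrightarrow> has_finite_cover (val p) (val q)"
proof -
  obtain e \<rho> e' \<rho>' where p: "p = (e, \<rho>)" and q: "q = (e', \<rho>')" by (cases p; cases q)
  have pres: "is_pres (e, \<rho>)" "is_pres (e', \<rho>')" and fam: "set_family_on (val p) (val q)"
    using pq by (auto simp: set_covering_instances_def p q)
  then obtain bs bs' where e: "e = FUnion bs" and e': "e' = FUnion bs'"
    by (cases e; cases e') (auto simp: set_family_on_def val_def p q eval.simps)
  have code: "pfst n = code_pres c (e, \<rho>)" "psnd n = code_pres c (e', \<rho>')"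
    by (simp_all add: n code_instance_def p q)
  have pres_less: "code_pres c (e, \<rho>) < L" "code_pres c (e', \<rho>') < L"
    using pfst_le[of n] psnd_le[of n] n(2) by (simp_all add: code)
  have pfst_pres: "pfst (code_pres c (e, \<rho>)) = code_expr e" for e and \<rho> :: "(var \<times> 'a) list"
    by (simp add: code_pres_def)
  have less: "code_expr (FUnion bs) < L" "code_expr (FUnion bs') < L"
    using pfst_le[of "pfst n"] pfst_le[of "psnd n"] pres_less
    by (simp_all add: code pfst_pres e e')
  have ext: "eval (FUnion bs) (vl s) = val p \<and> (\<forall>x<L. digit N s x < L)"
    if "extends N L (psnd (pfst n)) s" for s
    using that extends_iff[OF pres_less(1)] extends_eval[OF pres(1), of s] by (simp add: code e p)
  have ext': "eval (FUnion bs') (vl s) = val q \<and> (\<forall>x<L. digit N s x < L)"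
    if "extends N L (psnd (psnd n)) s" for s
    using that extends_iff[OF pres_less(2)] extends_eval[OF pres(2), of s] by (simp add: code e' q)
  \<comment> \<open>All extensions of the given valuations yield the same two sets, so the answer
    does not depend on the choice of \<open>s\<close> and \<open>s'\<close>.\<close>
  have iff: "cover_vl bs s bs' s' \<longleftrightarrow> has_finite_cover (val p) (val q)"
    if "s < B" "s' < B" "extends N L (psnd (pfst n)) s" "extends N L (psnd (psnd n)) s'" for s s'
    using cover_vl_iff[of bs s bs' s'] ext[OF that(3)] ext'[OF that(4)] fam less that(1,2) by simp
  show ?thesis
  proof
    assume "certified_cover N L n"
    then obtain W s s' where *: "justified_fm N L W" "justified_eq N L W" "s < B" "s' < B"
      "extends N L (psnd (pfst n)) s" "extends N L (psnd (psnd n)) s'"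
      "fact_cover N L W (code_expr (FUnion bs)) s (code_expr (FUnion bs')) s'"
      unfolding certified_cover_def code pfst_pres e e' by blast
    have "cover_vl bs s bs' s'"
      using fact_cover_sound[OF *(1,2,7) less *(3,4)] ext'[OF *(6)] fam by (simp add: set_family_on_def)
    then show "has_finite_cover (val p) (val q)" using iff[OF *(3-6)] by simp
  next
    assume cover: "has_finite_cover (val p) (val q)"
    obtain s s' where *: "s < B" "s' < B" "extends N L (psnd (pfst n)) s"
      "extends N L (psnd (psnd n)) s'"
      using ex_extends[OF pres(1) pres_less(1)] ex_extends[OF pres(2) pres_less(2)] by (auto simp: code)
    have "fact_cover N L (set_encode true_facts) (code_expr (FUnion bs)) s (code_expr (FUnion bs')) s'"
      using fact_cover_true[OF _ less *(1,2)] iff[OF *] cover by simp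
    then show "certified_cover N L n"
      unfolding certified_cover_def
      using * justified_fm_true justified_eq_true set_encode_less[OF true_facts_less]
      unfolding code pfst_pres e e' by blast
  qed
qed

end

theorem theorem5p7:
  fixes c :: "'a \<Rightarrow> nat"
  assumes "bij c"
  shows "decidable (code_instance c) set_covering_instances
           (\<lambda>(p, q). has_finite_cover (val p) (val q))"
proof -
  have "certified_cover (4 * Suc n) (Suc n) n \<longleftrightarrow> has_finite_cover (val p) (val q)"
    if "(p, q) \<in> set_covering_instances" "n = code_instance c (p, q)" for p q n
  proof -
    \<comment> \<open>The bound \<open>L = Suc n\<close> lies strictly above the code of the
      instance.\<close>
    interpret coding c "Suc n" "4 * Suc n" using assms by unfold_locales auto
    show ?thesis using certified_cover_iff[OF that] by simp
  qed
  then show ?thesis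
    using recp_certified_cover unfolding decidable_def recp_def rec1_def
    by (intro exI[of _ "\<lambda>xs. of_bool (certified_cover (4 * Suc (arg_at xs 0)) (Suc (arg_at xs 0))
      (arg_at xs 0))"]) auto
qed

end
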